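(* Let $\nu>-1$ and $q\in(0,1)$. Let $h_{\nu}^{(2)}(z;q)=2^{\nu}c_{\nu}(q)z^{1-\frac{\nu}{2}}J_{\nu}^{(2)}(\sqrt{z};q)$. Then the radius of convexity $r^{c}\left(h_{\nu}^{(2)}(z;q)\right)$ of the function $z\mapsto h_{\nu}^{(2)}(z;q)$ is the smallest positive root of the equation (in $r$) $$(2-\nu)^2 J_{\nu}^{(2)}(\sqrt{r};q)+(5-2\nu)\sqrt{r}\,\bigl(J_{\nu}^{(2)}\bigr)'(\sqrt{r};q)+r\,\bigl(J_{\nu}^{(2)}\bigr)''(\sqrt{r};q)=0,$$ where $(J_\nu^{(2)})'(\sqrt r;q)$ and $(J_\nu^{(2)})''(\sqrt r;q)$ denote the first and second derivatives of $x\mapsto J_\nu^{(2)}(x;q)$ evaluated at $x=\sqrt r$, and it satisfies the following inequalities: $$\frac{(1-q)(1-q^{\nu+1})}{q^{\nu+1}}<r^c\left(h_{\nu}^{(2)}(z;q)\right)<\frac{8(q^{\nu+1}-1)(q^{\nu+2}-1)(1-q^2)}{q^{\nu+1}U_{\nu}(q)},$$ $$\sqrt{\frac{8(1-q)^2(1+q)(1-q^{\nu+1})^2(1-q^{\nu+2})}{q^{2\nu+2}U_{\nu}(q)}}<r^c\left(h_{\nu}^{(2)}(z;q)\right)<\frac{2(1-q^{\nu+1})(q^{\nu+3}-1)U_{\nu}(q)T(q)}{(1+q)q^{\nu+1}\left(M_{\nu}(q)+N_{\nu}(q)\right)},$$ where $$U_{\nu}(q)=8q-8q^{\nu+2}+q^{\nu+3}-9q^2+8,$$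 $$M_{\nu}(q)=32q-16q^{\nu+2}-21q^{\nu+3}-37q^{\nu+4}+6q^{\nu+5}+11q^{\nu+6}+3q^{\nu+7},$$ $$N_{\nu}(q)=16q^{2\nu+5}+5q^{2\nu+6}+5q^{2\nu+7}+q^{2\nu+8}+5q^2-11q^3-27q^4+12q^6+16,$$ $$T(q)=(q-1)(q^3+2q^2+2q+1).$$
   Context: For $q\in(0,1)$ and $a\in\mathbb{R}$: $(a;q)_0=1$, $(a;q)_n=\prod_{k=1}^{n}(1-aq^{k-1})$, $(a;q)_\infty=\prod_{k\ge1}(1-aq^{k-1})$. The Jackson $q$-Bessel function is, for $\nu>-1$, $$J_{\nu}^{(2)}(z;q)=\frac{(q^{\nu+1};q)_{\infty}}{(q;q)_{\infty}}\sum_{n\geq0}\frac{(-1)^{n}\left(\frac{z}{2}\right)^{2n+\nu}}{(q;q)_{n}(q^{\nu+1};q)_{n}}q^{n(n+\nu)}.$$ Put $c_{\nu}(q)=(q;q)_{\infty}/(q^{\nu+1};q)_{\infty}$. The normalized function $h_\nu^{(2)}$ is understood as the entire function $$h_{\nu}^{(2)}(z;q)=2^{\nu}c_{\nu}(q)z^{1-\frac{\nu}{2}}J_{\nu}^{(2)}(\sqrt{z};q)=\sum_{n\geq0}\frac{(-1)^nq^{n(n+\nu)}}{4^n(q;q)_{n}(q^{\nu+1};q)_{n}}z^{n+1}.$$ With $\mathbb{D}_r=\{z\in\mathbb{C}:|z|<r\}$, the radius of convexity of an analytic function $f$ (with $f'(0)\neq0$) is $$r^{c}(f)=\sup\left\{r>0:\Re\left(1+\frac{zf''(z)}{f'(z)}\right)>0\text{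 for all }z\in\mathbb{D}_r\right\}.$$ *)

theory Defs
  imports "HOL-Analysis.Analysis"
begin

definition qpoch :: "real \<Rightarrow> real \<Rightarrow> nat \<Rightarrow> real" where
  "qpoch a q n = (\<Prod>k=1..n. 1 - a * q ^ (k - 1))"

(* The infinite product over k >= 1 of 1 - a q^(k-1), with the index shifted to start at 0. *)
definition qpoch_inf :: "real \<Rightarrow> real \<Rightarrow> real" where
  "qpoch_inf a q = (\<Prod>k. 1 - a * q ^ k)"

(* Used at both real and complex arguments; at complex ones, powr is the principal branch. *)
definition jackson_J2 ::
    "real \<Rightarrow> real \<Rightarrow> 'a \<Rightarrow> 'a::{ln, banach, real_normed_field}" where
  "jackson_J2 \<nu> q z =
     of_real (qpoch_inf (q powr (\<nu> + 1)) q / qpoch_inf q q) *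
     (\<Sum>n. (- 1) ^ n * (z / 2) powr of_real (2 * real n + \<nu>)
             / of_real (qpoch q q n * qpoch (q powr (\<nu> + 1)) q n)
             * of_real (q powr (real n * (real n + \<nu>))))"

definition c_norm :: "real \<Rightarrow> real \<Rightarrow> real" where
  "c_norm \<nu> q = qpoch_inf q q / qpoch_inf (q powr (\<nu> + 1)) q"

(* The branch cuts of the two powers and of the square root cancel, and 0 powr x = 0 gives
   the value 0 at z = 0, so this is the entire function of lemma h2_series for every z. *)
definition h2 :: "real \<Rightarrow> real \<Rightarrow> complex \<Rightarrow> complex" where
  "h2 \<nu> q z =
     of_real (2 powr \<nu> * c_norm \<nu> q) * z powr of_real (1 - \<nu> / 2)
       * jackson_J2 \<nu> q (csqrt z)"

(* For analytic f. The condition f' \<noteq> 0 makes explicit that the quotient is defined, since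
   x / 0 = 0. The supremum is taken in the extended reals. *)
definition radius_of_convexity :: "(complex \<Rightarrow> complex) \<Rightarrow> ereal" where
  "radius_of_convexity f =
     Sup {ereal r | r. r > 0 \<and>
       (\<forall>z\<in>ball 0 r. deriv f z \<noteq> 0 \<and>
          Re (1 + z * (deriv ^^ 2) f z / deriv f z) > 0)}"

definition convexity_lhs :: "real \<Rightarrow> real \<Rightarrow> real \<Rightarrow> real" where
  "convexity_lhs \<nu> q r =
     (2 - \<nu>) ^ 2 * jackson_J2 \<nu> q (sqrt r)
     + (5 - 2 * \<nu>) * sqrt r * deriv (jackson_J2 \<nu> q) (sqrt r)
     + r * (deriv ^^ 2) (jackson_J2 \<nu> q) (sqrt r)"

definition U_poly :: "real \<Rightarrow> real \<Rightarrow> real" where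
  "U_poly \<nu> q = 8 * q - 8 * q powr (\<nu> + 2) + q powr (\<nu> + 3) - 9 * q ^ 2 + 8"

definition M_poly :: "real \<Rightarrow> real \<Rightarrow> real" where
  "M_poly \<nu> q = 32 * q - 16 * q powr (\<nu> + 2) - 21 * q powr (\<nu> + 3) - 37 * q powr (\<nu> + 4)
     + 6 * q powr (\<nu> + 5) + 11 * q powr (\<nu> + 6) + 3 * q powr (\<nu> + 7)"

definition N_poly :: "real \<Rightarrow> real \<Rightarrow> real" where
  "N_poly \<nu> q = 16 * q powr (2 * \<nu> + 5) + 5 * q powr (2 * \<nu> + 6) + 5 * q powr (2 * \<nu> + 7)
     + q powr (2 * \<nu> + 8) + 5 * q ^ 2 - 11 * q ^ 3 - 27 * q ^ 4 + 12 * q ^ 6 + 16"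

definition T_poly :: "real \<Rightarrow> real" where
  "T_poly q = (q - 1) * (q ^ 3 + 2 * q ^ 2 + 2 * q + 1)"

lemma qpoch_inf_nonzero:
  assumes "0 < q" "q < 1" "0 < a" "a < 1"
  shows "qpoch_inf a q \<noteq> 0"
proof -
  have aq: "a * q ^ k < 1" for k
  proof -
    have "a * q ^ k \<le> a * 1"
      using assms by (intro mult_left_mono power_le_one) auto
    then show ?thesis using assms by linarith
  qed
  have "summable (\<lambda>k. norm ((1 - a * q ^ k) - 1))"
    using assms by (simp add: abs_mult power_abs summable_mult summable_geometric)
  then have "abs_convergent_prod (\<lambda>k. 1 - a * q ^ k)"
    by (simp add: abs_convergent_prod_conv_summable)
  then have "convergent_prod (\<lambda>k. 1 - a * q ^ k)"
    by (rule abs_convergent_prod_imp_convergent_prod)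
  moreover have "1 - a * q ^ k \<noteq> 0" for k
    using aq[of k] by linarith
  ultimately show ?thesis
    unfolding qpoch_inf_def by (rule prodinf_nonzero)
qed

lemma qpoch_Suc: "qpoch a q (Suc n) = qpoch a q n * (1 - a * q ^ n)"
  by (simp add: qpoch_def)

lemma qpoch_nonzero:
  assumes "0 < q" "q < 1" "0 < a" "a < 1"
  shows "qpoch a q n \<noteq> 0"
proof -
  have "a * q ^ k < 1" for k
  proof -
    have "a * q ^ k \<le> a * 1"
      using assms by (intro mult_left_mono power_le_one) auto
    then show ?thesis using assms by linarith
  qed
  then have "1 - a * q ^ k \<noteq> 0" for k
    by (metis less_irrefl eq_iff_diff_eq_0)
  then show ?thesis by (simp add: qpoch_def)
qed

definition h2_coeff :: "real \<Rightarrow> real \<Rightarrow> nat \<Rightarrow> real" where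
  "h2_coeff \<nu> q n = (- 1) ^ n * q powr (real n * (real n + \<nu>))
     / (4 ^ n * qpoch q q n * qpoch (q powr (\<nu> + 1)) q n)"

lemma h2_summable:
  fixes z :: complex
  assumes "\<nu> > - 1" "0 < q" "q < 1"
  shows "summable (\<lambda>n. of_real (h2_coeff \<nu> q n) * z ^ n)"
proof -
  define a where "a = q powr (\<nu> + 1)"
  have a: "0 < a" "a < 1"
    using assms powr_less_mono2[of "\<nu> + 1" q 1] by (auto simp: a_def)
  define w where "w = (\<lambda>n. - (q powr (2 * real n + 1 + \<nu>) / (4 * (1 - q * q ^ n) * (1 - a * q ^ n))))"
  have step: "h2_coeff \<nu> q (Suc n) = h2_coeff \<nu> q n * w n" for n
  proof -
    have "q powr (real (Suc n) * (real (Suc n) + \<nu>))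
        = q powr (real n * (real n + \<nu>)) * q powr (2 * real n + 1 + \<nu>)"
      by (simp add: powr_add [symmetric] algebra_simps)
    then show ?thesis
      by (simp add: h2_coeff_def w_def a_def qpoch_Suc mult_ac del: right_diff_distrib_numeral)
  qed
  have pn: "(\<lambda>n. q ^ n) \<longlonglongrightarrow> 0"
    using assms by (intro LIMSEQ_realpow_zero) auto
  have p: "q powr (2 * real n + 1 + \<nu>) = a * (q ^ n) ^ 2" for n
  proof -
    have "q powr (2 * real n + 1 + \<nu>) = q powr (\<nu> + 1) * q powr real (n * 2)"
      by (simp add: powr_add [symmetric] algebra_simps)
    also have "q powr real (n * 2) = q ^ (n * 2)"
      using assms by (subst powr_realpow) auto
    finally show ?thesis by (simp add: a_def power_mult)
  qed
  have "w \<longlonglongrightarrow> - (a * 0 ^ 2 / (4 * (1 - q * 0) * (1 - a * 0)))"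
    unfolding w_def p by (intro tendsto_intros pn) auto
  then have "(\<lambda>n. norm (w n) * norm z) \<longlonglongrightarrow> 0"
    by (intro tendsto_mult_left_zero tendsto_norm_zero) simp
  then have "eventually (\<lambda>n. norm (w n) * norm z < 1 / 2) sequentially"
    by (rule order_tendstoD) simp
  then obtain N where N: "\<And>n. n \<ge> N \<Longrightarrow> norm (w n) * norm z < 1 / 2"
    by (auto simp: eventually_sequentially)
  show ?thesis
  proof (rule summable_ratio_test[of "1 / 2" N])
    fix n assume "n \<ge> N"
    have "norm (of_real (h2_coeff \<nu> q (Suc n)) * z ^ Suc n)
        = (norm (w n) * norm z) * norm (of_real (h2_coeff \<nu> q n) * z ^ n)"
      by (simp add: step norm_mult norm_power abs_mult)
    also have "\<dots> \<le> 1 / 2 * norm (of_real (h2_coeff \<nu> q n) * z ^ n)"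
      using N[OF \<open>n \<ge> N\<close>] by (intro mult_right_mono) auto
    finally show "norm (of_real (h2_coeff \<nu> q (Suc n)) * z ^ Suc n)
        \<le> 1 / 2 * norm (of_real (h2_coeff \<nu> q n) * z ^ n)" .
  qed simp
qed

lemma h2_series:
  assumes "\<nu> > - 1" "0 < q" "q < 1"
  shows "h2 \<nu> q z = (\<Sum>n. of_real (h2_coeff \<nu> q n) * z ^ (n + 1))"
proof (cases "z = 0")
  case True
  then show ?thesis by (simp add: h2_def)
next
  case False
  define a where "a = q powr (\<nu> + 1)"
  have a: "0 < a" "a < 1"
    using assms powr_less_mono2[of "\<nu> + 1" q 1] by (auto simp: a_def)
  define P where "P = (csqrt z / 2) powr of_real \<nu>"
  have "csqrt z = exp (Ln z / 2)"
    using False by (simp add: csqrt_exp_Ln)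
  have lnh: "Ln (csqrt z / 2) = Ln z / 2 - of_real (ln 2)"
  proof -
    have "Ln (csqrt z / 2) = Ln (csqrt z) - of_real (ln 2)"
      using False Ln_divide_of_real[of 2 "csqrt z"] by simp
    also have "Ln (csqrt z) = Ln z / 2"
      unfolding \<open>csqrt z = exp (Ln z / 2)\<close>
      using mpi_less_Im_Ln[OF False] Im_Ln_le_pi[OF False] by (intro Ln_exp) auto
    finally show ?thesis .
  qed
  have P: "of_real (2 powr \<nu>) * z powr of_real (1 - \<nu> / 2) * P = z"
  proof -
    have "of_real (2 powr \<nu>) = exp (of_real \<nu> * of_real (ln 2) :: complex)"
      by (simp add: powr_def exp_of_real[symmetric])
    moreover have "z powr of_real (1 - \<nu> / 2) = exp (of_real (1 - \<nu> / 2) * Ln z)"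
      using False by (simp add: powr_def)
    moreover have "P = exp (of_real \<nu> * (Ln z / 2 - of_real (ln 2)))"
      using False lnh by (simp add: P_def powr_def)
    ultimately have "of_real (2 powr \<nu>) * z powr of_real (1 - \<nu> / 2) * P
        = exp (of_real \<nu> * of_real (ln 2) + of_real (1 - \<nu> / 2) * Ln z
               + of_real \<nu> * (Ln z / 2 - of_real (ln 2)))"
      by (simp add: exp_add)
    also have "of_real \<nu> * of_real (ln 2) + of_real (1 - \<nu> / 2) * Ln z
               + of_real \<nu> * (Ln z / 2 - of_real (ln 2)) = Ln z"
      by (simp add: field_simps)
    finally show ?thesis using False by simp
  qed
  have pw: "(csqrt z / 2) powr of_real (2 * real n + \<nu>) = P * z ^ n / 4 ^ n" for n
  proof -
    have "(csqrt z / 2) powr of_real (2 * real n + \<nu>) = (csqrt z / 2) powr of_nat (2 * n) * P"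
      by (simp add: P_def powr_add)
    also have "(csqrt z / 2) powr of_nat (2 * n) = (csqrt z / 2) ^ (2 * n)"
      using False by (subst powr_nat') auto
    also have "\<dots> = z ^ n / 4 ^ n"
      by (simp add: power_mult power_divide)
    finally show ?thesis by simp
  qed
  define t where "t = (\<lambda>n. of_real (h2_coeff \<nu> q n) * z ^ n)"
  have S: "summable t"
    unfolding t_def by (rule h2_summable[OF assms])
  have "(- 1) ^ n * (csqrt z / 2) powr of_real (2 * real n + \<nu>)
             / of_real (qpoch q q n * qpoch (q powr (\<nu> + 1)) q n)
             * of_real (q powr (real n * (real n + \<nu>))) = P * t n" for n
    unfolding pw t_def h2_coeff_def by (simp add: mult_ac)
  then have "jackson_J2 \<nu> q (csqrt z) = of_real (qpoch_inf a q / qpoch_inf q q) * (P * suminf t)"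
    unfolding jackson_J2_def a_def by (simp add: suminf_mult[OF S])
  then have "h2 \<nu> q z
      = (of_real (2 powr \<nu>) * z powr of_real (1 - \<nu> / 2) * P)
        * of_real (c_norm \<nu> q * (qpoch_inf a q / qpoch_inf q q)) * suminf t"
    by (simp add: h2_def)
  also have "c_norm \<nu> q * (qpoch_inf a q / qpoch_inf q q) = 1"
    using qpoch_inf_nonzero[of q a] qpoch_inf_nonzero[of q q] a assms
    by (simp add: c_norm_def a_def)
  finally have "h2 \<nu> q z = z * suminf t"
    by (simp only: P of_real_1 mult_1_right)
  also have "\<dots> = (\<Sum>n. z * t n)"
    by (rule suminf_mult[OF S, symmetric])
  finally show ?thesis
    by (simp add: t_def mult_ac)
qed

end

theory Submission
  imports Defs
begin

text \<open>Write \<open>h z = z * (\<Sum>n. b n * z ^ n)\<close> and \<open>\<Phi> = (z h')'\<close>, so that \<open>1 + z h'' / h' = \<Phi> / h'\<close>. The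
  functions \<open>h'\<close> and \<open>\<Phi>\<close> have the coefficients \<open>(n + 1) * b n\<close> and \<open>(n + 1)\<^sup>2 * b n\<close>.

  Suppose that \<open>f\<close>, normalized by \<open>f 0 = 1\<close>, is \<open>h'\<close> or \<open>\<Phi>\<close> and has positive zeros only. Let \<open>S k\<close> be
  the sum of the \<open>k\<close>-th powers of the reciprocals of its zeros. Then
  \<open>- f' z / f z = (\<Sum>k. S (k + 1) * z ^ k)\<close> up to the smallest zero. For \<open>h'\<close> this gives
  \<open>\<Phi> z / h' z = 1 - (\<Sum>k. S (k + 1) * z ^ (k + 1))\<close> with nonnegative \<open>S\<close>, so the real part of
  the quotient at \<open>z\<close> is at least its value at \<open>|z|\<close>. Therefore the radius of convexity is the
  smallest positive zero of \<open>\<Phi>\<close> (\<open>radius_of_convexity_eq\<close>), and up to a nonvanishing factor \<open>\<Phi>\<close> is the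
  left-hand side of the equation in the theorem (\<open>convexity_lhs_pseries\<close>). For \<open>\<Phi>\<close> the four
  estimates are the Euler--Rayleigh inequalities \<open>S k powr (- 1 / k) < r < S k / S (k + 1)\<close> for
  \<open>k = 1, 2\<close>, where \<open>r\<close> is the smallest zero; Newton's identities express \<open>S 1\<close>, \<open>S 2\<close>, \<open>S 3\<close> in terms of the
  first coefficients.

  To see that the zeros are positive, the functions are approximated by polynomials. Call the
  positive zeros of a polynomial separated if consecutive ones have ratio at least \<open>1 / q\<close>. An
  interlacing argument (\<open>separated_roots_step\<close>) shows that \<open>p x \<mapsto> p x - (\<alpha> + \<beta> x) * p (q x)\<close> with
  \<open>0 \<le> \<alpha> < 1\<close> and \<open>0 \<le> \<beta>\<close> preserves separation. Starting from the constant \<open>1\<close>, such steps produce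
  polynomials whose coefficients, divided by the constant one, tend to \<open>b\<close>: steps with \<open>\<alpha> = 0\<close> yield
  \<open>q ^ n\<^sup>2 / (q;q)\<^sub>n\<close>, and steps with \<open>\<beta> = 0\<close> the factor \<open>1 / (q\<^bsup>\<nu>+1\<^esup>;q)\<^sub>n\<close>. Rolle's theorem covers the
  factors \<open>n + 1\<close>.

  The limit is taken on the level of power sums instead of zeros (\<open>root_moments_limit\<close>). Newton's
  identities and the inequalities between the power sums and the largest reciprocal \<open>u\<close> of a zero
  pass to the limit, and they suffice: they imply that the limit function has no zero
  in \<open>|z| < 1 / u\<close> and vanishes at \<open>1 / u\<close> (\<open>pseries_eq_exp\<close>, \<open>pseries_zero_at_inverse\<close>). What could
  be lost is strictness of the Euler--Rayleigh inequalities; it is recovered from the rapid decay of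
  the coefficients (\<open>root_moments_strict\<close>).\<close>

section \<open>Factorization from real zeros\<close>

lemma degree_prod_linear_le:
  fixes a :: "nat \<Rightarrow> real"
  shows "degree (\<Prod>i<n. [:1, a i:]) \<le> n"
proof -
  have "degree (\<Prod>i<n. [:1, a i:]) \<le> (\<Sum>i<n. degree [:1, a i:])"
    by (rule order_trans[OF degree_prod_sum_le]) auto
  also have "\<dots> \<le> (\<Sum>i<n. 1)" by (intro sum_mono) auto
  finally show ?thesis by simp
qed

text \<open>Comparing at the \<open>n\<close> zeros and at \<open>0\<close> gives \<open>n + 1\<close> points, enough to determine a
  polynomial of degree at most \<open>n\<close>. So finding \<open>n\<close> real zeros by sign changes already
  yields the full factorization, with no complex zeros left over.\<close>
lemma poly_eq_prod_of_roots:
  fixes p :: "real poly"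
  assumes "degree p \<le> n" and "inj_on y {..<n}"
    and "\<And>i. i < n \<Longrightarrow> y i \<noteq> 0" and "\<And>i. i < n \<Longrightarrow> poly p (y i) = 0"
  shows "p = smult (poly p 0) (\<Prod>i<n. [:1, - 1 / y i:])"
proof (rule ccontr)
  let ?P = "smult (poly p 0) (\<Prod>i<n. [:1, - 1 / y i:])"
  assume ne: "p \<noteq> ?P"
  have "degree ?P \<le> n" by (rule order_trans[OF degree_smult_le degree_prod_linear_le])
  then have deg: "degree (p - ?P) \<le> n" using assms(1) degree_diff_le by blast
  have "poly (p - ?P) x = 0" if x: "x \<in> insert 0 (y ` {..<n})" for x
  proof (cases "x = 0")
    case True
    then show ?thesis by (simp add: poly_prod)
  next
    case False
    then obtain i where i: "i < n" "x = y i" using x by auto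
    have "(\<Prod>j<n. poly [:1, - 1 / y j:] x) = 0"
      using i assms(3)[OF i(1)] by (intro prod_zero bexI[of _ i]) auto
    then show ?thesis using i assms(4) by (simp add: poly_prod)
  qed
  then have "insert 0 (y ` {..<n}) \<subseteq> {x. poly (p - ?P) x = 0}" by blast
  then have "card (insert 0 (y ` {..<n})) \<le> card {x. poly (p - ?P) x = 0}"
    using ne by (intro card_mono poly_roots_finite) auto
  also have "\<dots> \<le> n" using ne deg card_poly_roots_bound[of "p - ?P"] by simp
  finally have "card (insert 0 (y ` {..<n})) \<le> n" .
  moreover have "0 \<notin> y ` {..<n}" using assms(3) by force
  ultimately show False using assms(2) by (simp add: card_image)
qed

section \<open>Zeros from sign changes\<close>

text \<open>Passing a zero flips the sign. The inequalities are weak so that \<open>t\<close> may itself be a zero,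
  which happens when neighbouring zeros are exactly as close as the separation allows.\<close>
lemma alternating_sign_prod:
  fixes x :: "nat \<Rightarrow> real"
  assumes "i \<le> n" and "\<And>j. j < n \<Longrightarrow> 0 < x j"
    and "\<And>j. j < i \<Longrightarrow> x j \<le> t" and "\<And>j. i \<le> j \<Longrightarrow> j < n \<Longrightarrow> t \<le> x j"
  shows "0 \<le> (- 1) ^ i * (\<Prod>j<n. 1 - t / x j)"
proof -
  have "(\<Prod>j<n. 1 - t / x j) = (\<Prod>j<i. 1 - t / x j) * (\<Prod>j\<in>{i..<n}. 1 - t / x j)"
    using assms(1) by (simp add: prod.atLeastLessThan_concat lessThan_atLeast0)
  moreover have "(- 1) ^ i * (\<Prod>j<i. 1 - t / x j) = (\<Prod>j<i. t / x j - 1)"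
  proof -
    have "(- 1) ^ i * (\<Prod>j<i. 1 - t / x j) = (\<Prod>j<i. (- 1) * (1 - t / x j))"
      by (subst prod.distrib) simp
    then show ?thesis by simp
  qed
  ultimately have "(- 1) ^ i * (\<Prod>j<n. 1 - t / x j)
      = (\<Prod>j<i. t / x j - 1) * (\<Prod>j\<in>{i..<n}. 1 - t / x j)"
    by (simp add: mult.assoc[symmetric])
  also have "\<dots> \<ge> 0"
  proof (intro mult_nonneg_nonneg prod_nonneg ballI)
    show "0 \<le> t / x j - 1" if "j \<in> {..<i}" for j
      using that assms(1) assms(2,3)[of j] by simp
    show "0 \<le> 1 - t / x j" if "j \<in> {i..<n}" for j
      using that assms(2,4)[of j] by simp
  qed
  finally show ?thesis .
qed

lemma poly_root_between:
  fixes p :: "real poly"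
  assumes "a \<le> b" "0 \<le> s * poly p a" "s * poly p b \<le> 0" "s \<noteq> 0"
  shows "\<exists>y. a \<le> y \<and> y \<le> b \<and> poly p y = 0"
proof -
  have "\<exists>y. a \<le> y \<and> y \<le> b \<and> s * poly p y = 0"
    using assms(1-3) by (intro IVT2') (auto intro!: continuous_intros)
  then show ?thesis using assms(4) by auto
qed

section \<open>Positive zeros and Rolle's theorem\<close>

text \<open>Normalizing by the value at \<open>0\<close> makes the reciprocals of the zeros the natural
  parameters: the coefficients are then their elementary symmetric functions up to sign, a form
  that survives the passage to entire functions. A positive value at \<open>0\<close> fixes all signs.\<close>
definition simple_positive_roots :: "real poly \<Rightarrow> bool" where
  "simple_positive_roots p \<longleftrightarrow> 0 < poly p 0 \<and>
     (\<exists>n x. (\<forall>i<n. 0 < x i) \<and> (\<forall>i. Suc i < n \<longrightarrow> x i < x (Suc i)) \<and>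
        p = smult (poly p 0) (\<Prod>i<n. [:1, - 1 / x i:]))"

text \<open>Consecutive zeros of \<open>p\<close> have ratio at least \<open>1 / q\<close>. Equivalently, the zeros of
  \<open>p x\<close> and of \<open>p (q x)\<close> interlace weakly.\<close>
definition separated_roots :: "real \<Rightarrow> real poly \<Rightarrow> bool" where
  "separated_roots q p \<longleftrightarrow> 0 < poly p 0 \<and>
     (\<exists>n x. (\<forall>i<n. 0 < x i) \<and> (\<forall>i. Suc i < n \<longrightarrow> x i / q \<le> x (Suc i)) \<and>
        p = smult (poly p 0) (\<Prod>i<n. [:1, - 1 / x i:]))"

lemma increasing_below:
  fixes x :: "nat \<Rightarrow> real"
  assumes "\<And>i. Suc i < n \<Longrightarrow> x i < x (Suc i)" and "i < j" "j < n"
  shows "x i < x j"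
  using assms(2,3)
proof (induction j)
  case (Suc j)
  then have "x j < x (Suc j)" using assms(1) by simp
  then show ?case using Suc by (cases "i = j") auto
qed simp

lemma increasing_inj_on:
  fixes x :: "nat \<Rightarrow> real"
  assumes "\<And>i. Suc i < n \<Longrightarrow> x i < x (Suc i)"
  shows "inj_on x {..<n}"
proof (rule inj_onI)
  fix i j assume "i \<in> {..<n}" "j \<in> {..<n}" "x i = x j"
  then show "i = j"
    using increasing_below[of n x i j] increasing_below[of n x j i] assms
    by (cases i j rule: linorder_cases) auto
qed

lemma separated_imp_simple:
  assumes "0 < q" "q < 1" "separated_roots q p"
  shows "simple_positive_roots p"
proof -
  obtain n x where x: "\<forall>i<n. 0 < x i" "\<forall>i. Suc i < n \<longrightarrow> x i / q \<le> x (Suc i)"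
    "p = smult (poly p 0) (\<Prod>i<n. [:1, - 1 / x i:])" and p0: "0 < poly p 0"
    using assms(3) unfolding separated_roots_def by blast
  have "x i < x (Suc i)" if "Suc i < n" for i
  proof -
    have "x i * q < x i" using x(1) that assms by simp
    then have "x i < x i / q" using assms by (simp add: pos_less_divide_eq)
    then show ?thesis using x(2) that by fastforce
  qed
  then show ?thesis unfolding simple_positive_roots_def using x p0 by blast
qed

text \<open>On coefficients, \<open>p \<mapsto> (x p)'\<close> multiplies the \<open>k\<close>-th one by \<open>k + 1\<close>. Rolle's theorem between
  the zeros \<open>0, x 0, x 1, \<dots>\<close> of \<open>x p\<close> produces as many zeros as \<open>p\<close> has. Two uses take the
  series of \<open>h / z\<close> to that of \<open>h'\<close> and then of \<open>(z h')'\<close>.\<close>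
lemma simple_roots_Rolle:
  assumes "simple_positive_roots p"
  shows "simple_positive_roots (pderiv (pCons 0 p))"
proof -
  obtain n x where x: "\<forall>i<n. 0 < x i" "\<forall>i. Suc i < n \<longrightarrow> x i < x (Suc i)"
    and p: "p = smult (poly p 0) (\<Prod>i<n. [:1, - 1 / x i:])" and p0: "0 < poly p 0"
    using assms unfolding simple_positive_roots_def by blast
  let ?r = "pCons 0 p"
  define l where "l i = (case i of 0 \<Rightarrow> 0 | Suc j \<Rightarrow> x j)" for i
  have px: "poly p (x i) = 0" if "i < n" for i
  proof -
    have "poly p (x i) = poly p 0 * (\<Prod>j<n. 1 - x i / x j)"
      by (subst p) (simp add: poly_prod)
    also have "(\<Prod>j<n. 1 - x i / x j) = 0"
      using that x(1) by (intro prod_zero bexI[of _ i]) auto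
    finally show ?thesis by simp
  qed
  have ex: "\<exists>y. l i < y \<and> y < x i \<and> poly (pderiv ?r) y = 0" if i: "i < n" for i
  proof -
    have "l i < x i" using i x by (auto simp: l_def split: nat.splits)
    moreover have "poly ?r (l i) = 0" using i px by (auto simp: l_def split: nat.splits)
    moreover have "poly ?r (x i) = 0" using px[OF i] by simp
    ultimately show ?thesis using poly_MVT[of "l i" "x i" ?r] by force
  qed
  then obtain y where y: "\<And>i. i < n \<Longrightarrow> l i < y i \<and> y i < x i \<and> poly (pderiv ?r) (y i) = 0"
    by metis
  have pos: "0 < y i" if "i < n" for i
    using y[OF that] x(1) that by (auto simp: l_def split: nat.splits intro: less_trans)
  have mono: "y i < y (Suc i)" if "Suc i < n" for i
    using y[of i] y[of "Suc i"] that by (auto simp: l_def)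
  have "degree p \<le> n"
    by (subst p) (rule order_trans[OF degree_smult_le degree_prod_linear_le])
  then have deg: "degree (pderiv ?r) \<le> n"
    by (simp add: degree_pderiv)
  have "pderiv ?r = smult (poly (pderiv ?r) 0) (\<Prod>i<n. [:1, - 1 / y i:])"
    using deg increasing_inj_on[of n y] mono pos y
    by (intro poly_eq_prod_of_roots) (auto simp: less_imp_neq[symmetric])
  moreover have "poly (pderiv ?r) 0 = poly p 0" by (simp add: pderiv_pCons)
  ultimately show ?thesis unfolding simple_positive_roots_def using pos mono p0 by metis
qed

section \<open>Preservation of separated zeros\<close>

text \<open>Let \<open>x i\<close> be the zeros of \<open>p\<close>. At \<open>x (i - 1) / q\<close> the subtracted term vanishes and at \<open>x i\<close>
  the first one does, and by separation the remaining terms have weakly opposite signs there. So the new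
  polynomial has a zero between \<open>x (i - 1) / q\<close> and \<open>x i\<close>. These intervals are such that
  consecutive new zeros are separated again: the new zero after that one is at least \<open>x i / q\<close>.
  It is this invariance that makes separation, rather than mere reality of the zeros, the right
  hypothesis: for zeros that are closer together the same operation can create complex zeros.\<close>
lemma separated_roots_step:
  fixes p :: "real poly"
  assumes q: "0 < q" "q < 1" and al: "0 \<le> \<alpha>" "\<alpha> < 1" and be: "0 \<le> \<beta>"
    and sep: "separated_roots q p"
  shows "separated_roots q (p - [:\<alpha>, \<beta>:] * pcompose p [:0, q:])"
proof -
  obtain n x where xpos: "\<And>i. i < n \<Longrightarrow> 0 < x i"
    and xsep: "\<And>i. Suc i < n \<Longrightarrow> x i / q \<le> x (Suc i)"
    and p: "p = smult (poly p 0) (\<Prod>i<n. [:1, - 1 / x i:])" and p0: "0 < poly p 0"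
    using sep unfolding separated_roots_def by blast
  define g where "g = p - [:\<alpha>, \<beta>:] * pcompose p [:0, q:]"
  (* Left end of the interval for the i-th new zero; its right end is x i, if i < n. *)
  define l where "l i = (case i of 0 \<Rightarrow> 0 | Suc j \<Rightarrow> x j / q)" for i
  have xq: "x i < x i / q" if "i < n" for i
    using xpos[OF that] q by (simp add: pos_less_divide_eq)
  have xinc: "x i < x j" if "i < j" "j < n" for i j
    using increasing_below[of n x i j] that xsep xq by (meson Suc_lessD less_le_trans)
  have pt: "poly p t = poly p 0 * (\<Prod>j<n. 1 - t / x j)" for t
    by (subst p) (simp add: poly_prod)
  have sign: "0 \<le> (- 1) ^ i * poly p t"
    if "i \<le> n" "i > 0 \<Longrightarrow> x (i - 1) \<le> t" "i < n \<Longrightarrow> t \<le> x i" for i t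
  proof -
    have "0 \<le> (- 1) ^ i * (\<Prod>j<n. 1 - t / x j)"
    proof (rule alternating_sign_prod)
      fix j assume "j < i"
      then have "x j \<le> x (i - 1)"
        using xinc[of j "i - 1"] that(1) by (cases "j = i - 1") (auto simp: less_imp_le)
      then show "x j \<le> t" using that(2) \<open>j < i\<close> by simp
    next
      fix j assume "i \<le> j" "j < n"
      then have "x i \<le> x j" using xinc[of i j] by (cases "i = j") (auto simp: less_imp_le)
      then show "t \<le> x j" using that(3) \<open>i \<le> j\<close> \<open>j < n\<close> by simp
    qed (use that xpos in auto)
    then have "0 \<le> poly p 0 * ((- 1) ^ i * (\<Prod>j<n. 1 - t / x j))" using p0 by simp
    then show ?thesis by (subst pt) (simp add: mult_ac)
  qed
  have root: "poly p (x i) = 0" if "i < n" for i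
  proof -
    have "(\<Prod>j<n. 1 - x i / x j) = 0"
      using that xpos[OF that] by (intro prod_zero bexI[of _ i]) auto
    then show ?thesis by (subst pt) simp
  qed
  have gt: "poly g t = poly p t - (\<alpha> + \<beta> * t) * poly p (q * t)" for t
    by (simp add: g_def poly_pcompose algebra_simps)
  have g0: "0 < poly g 0" using al p0 by (simp add: gt algebra_simps)
  have lpos: "0 \<le> l i" if "i \<le> n" for i
    using that xpos q by (auto simp: l_def less_imp_le split: nat.splits)
  have left: "0 \<le> (- 1) ^ i * poly g (l i)" if "i \<le> n" for i
  proof (cases i)
    case 0
    then show ?thesis using g0 by (simp add: l_def)
  next
    case (Suc j)
    then have "poly p (q * l i) = 0" using that q root[of j] by (simp add: l_def)
    moreover have "0 \<le> (- 1) ^ i * poly p (l i)"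
      using that Suc xsep[of j] xq[of j] by (intro sign) (auto simp: l_def)
    ultimately show ?thesis by (simp add: gt)
  qed
  have right: "(- 1) ^ i * poly g (x i) \<le> 0" if "i < n" for i
  proof -
    have "0 \<le> (- 1) ^ i * poly p (q * x i)"
    proof (rule sign)
      show "x (i - 1) \<le> q * x i" if "i > 0"
        using xsep[of "i - 1"] \<open>i < n\<close> that q by (simp add: pos_divide_le_eq mult.commute)
      show "q * x i \<le> x i" using xpos[OF \<open>i < n\<close>] q by simp
    qed (use that in simp)
    then have "0 \<le> (\<alpha> + \<beta> * x i) * ((- 1) ^ i * poly p (q * x i))"
      using al be xpos[OF that] by simp
    then show ?thesis by (simp add: gt root that mult_ac)
  qed
  have lx: "l i \<le> x i" if "i < n" for i
    using that xpos[of i] xsep by (auto simp: l_def less_imp_le split: nat.splits)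
  have ex: "\<exists>y. l i \<le> y \<and> y \<le> x i \<and> poly g y = 0" if "i < n" for i
    using left[of i] right[of i] lx that by (intro poly_root_between[of _ _ "(- 1) ^ i"]) auto
  (* A positive \<beta> raises the degree by one. The extra zero lies beyond all the others: the product
     with [:\<alpha>, \<beta>:] dominates at infinity and carries the sign opposite to that of g at l n. *)
  have ex_top: "\<exists>y. l n \<le> y \<and> poly g y = 0" if "\<beta> > 0"
  proof -
    have degp: "degree p = n"
    proof -
      have "degree (\<Prod>i<n. [:1, - 1 / x i:]) = (\<Sum>i<n. degree [:1, - 1 / x i:])"
        by (rule degree_prod_eq_sum_degree) auto
      also have "\<dots> = (\<Sum>i<n. 1)"
      proof (rule sum.cong)
        fix i assume "i \<in> {..<n}"
        then show "degree [:1, - 1 / x i:] = 1" using xpos[of i] by simp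
      qed simp
      finally show ?thesis using p0 by (subst p) simp
    qed
    have lcp: "0 < (- 1) ^ n * lead_coeff p"
    proof -
      have "lead_coeff p = poly p 0 * (\<Prod>i<n. lead_coeff [:1, - 1 / x i:])"
        using arg_cong[OF p, of lead_coeff] by (simp only: lead_coeff_smult lead_coeff_prod)
      also have "(\<Prod>i<n. lead_coeff [:1, - 1 / x i:]) = (\<Prod>i<n. (- 1) * (1 / x i))"
        using xpos by (intro prod.cong) (auto dest!: xpos)
      also have "\<dots> = (- 1) ^ n * (\<Prod>i<n. 1 / x i)" by (subst prod.distrib) simp
      finally have "(- 1) ^ n * lead_coeff p = poly p 0 * (\<Prod>i<n. 1 / x i)" by simp
      also have "\<dots> > 0" using p0 xpos by (intro mult_pos_pos prod_pos) auto
      finally show ?thesis .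
    qed
    define r where "r = [:\<alpha>, \<beta>:] * pcompose p [:0, q:]"
    have pn: "p \<noteq> 0" using p0 by auto
    have degc: "degree (pcompose p [:0, q:]) = n" using q degp by (simp add: degree_pcompose)
    have lcc: "lead_coeff (pcompose p [:0, q:]) = lead_coeff p * q ^ n"
      using q degp by (subst lead_coeff_comp) auto
    have "pcompose p [:0, q:] \<noteq> 0" using lcc pn q by auto
    then have degr: "degree r = Suc n"
      unfolding r_def using that degc by (subst degree_mult_eq) auto
    have lcr: "lead_coeff r = \<beta> * (lead_coeff p * q ^ n)"
    proof -
      have "lead_coeff r = lead_coeff [:\<alpha>, \<beta>:] * lead_coeff (pcompose p [:0, q:])"
        unfolding r_def by (rule lead_coeff_mult)
      then show ?thesis using lcc that by simp
    qed
    have "lead_coeff (r - p) = lead_coeff r"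
      using degr degp by (simp add: lead_coeff_add_le[symmetric] coeff_eq_0 degree_diff_less
        degree_add_eq_left[of "- p" r, simplified])
    define e where "e = smult ((- 1) ^ n) (r - p)"
    have "lead_coeff e = (- 1) ^ n * lead_coeff r"
      unfolding e_def lead_coeff_smult \<open>lead_coeff (r - p) = lead_coeff r\<close> ..
    also have "\<dots> = \<beta> * q ^ n * ((- 1) ^ n * lead_coeff p)"
      unfolding lcr by simp
    also have "\<dots> > 0" using that q lcp by simp
    finally have lce: "0 < lead_coeff e" .
    obtain X where X: "\<And>t. t \<ge> X \<Longrightarrow> lead_coeff e \<le> poly e t"
      using poly_pinfty_gt_lc[OF lce] by blast
    define t where "t = max X (l n)"
    have "lead_coeff e \<le> poly e t" by (rule X) (simp add: t_def)
    then have "0 \<le> (- 1) ^ n * (poly r t - poly p t)"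
      using lce by (simp add: e_def)
    then have "(- 1) ^ n * poly g t \<le> 0" by (simp add: g_def r_def algebra_simps)
    then show ?thesis
      using left[of n] poly_root_between[of "l n" t "(- 1) ^ n" g] by (auto simp: t_def)
  qed
  define m where "m = (if \<beta> = 0 then n else Suc n)"
  have "\<exists>y. l i \<le> y \<and> (i < n \<longrightarrow> y \<le> x i) \<and> poly g y = 0" if "i < m" for i
    using that ex[of i] ex_top be by (cases "i < n") (auto simp: m_def less_Suc_eq split: if_splits)
  then obtain y where y: "\<And>i. i < m \<Longrightarrow> l i \<le> y i \<and> (i < n \<longrightarrow> y i \<le> x i) \<and> poly g (y i) = 0"
    by metis
  have mn: "m \<le> Suc n" by (simp add: m_def)
  have ypos: "0 < y i" if "i < m" for i
  proof -
    have "y i \<noteq> 0" using y[OF that] g0 by auto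
    then show ?thesis using y[OF that] lpos[of i] that mn by force
  qed
  have ysep: "y i / q \<le> y (Suc i)" if "Suc i < m" for i
  proof -
    have "y i / q \<le> x i / q" using y[of i] that mn q by (intro divide_right_mono) auto
    also have "\<dots> \<le> y (Suc i)" using y[of "Suc i"] that by (simp add: l_def)
    finally show ?thesis .
  qed
  have "y i < y (Suc i)" if "Suc i < m" for i
  proof -
    have "y i < y i / q" using ypos[of i] that q by (simp add: pos_less_divide_eq)
    then show ?thesis using ysep[OF that] by linarith
  qed
  then have inj: "inj_on y {..<m}" by (rule increasing_inj_on)
  have "degree p \<le> n"
    by (subst p) (rule order_trans[OF degree_smult_le degree_prod_linear_le])
  then have degc: "degree (pcompose p [:0, q:]) \<le> n" using q by (simp add: degree_pcompose)
  have deg: "degree g \<le> m"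
  proof -
    have "degree ([:\<alpha>, \<beta>:] * pcompose p [:0, q:]) \<le> degree [:\<alpha>, \<beta>:] + degree (pcompose p [:0, q:])"
      by (rule degree_mult_le)
    also have "\<dots> \<le> m" using degc by (simp add: m_def)
    finally show ?thesis
      unfolding g_def using \<open>degree p \<le> n\<close> by (intro degree_diff_le) (auto simp: m_def)
  qed
  have "g = smult (poly g 0) (\<Prod>i<m. [:1, - 1 / y i:])"
    using deg inj ypos y by (intro poly_eq_prod_of_roots) (auto simp: less_imp_neq[symmetric])
  then show ?thesis
    unfolding separated_roots_def g_def[symmetric] using g0 ypos ysep by blast
qed

section \<open>Polynomial approximants of the \<open>q\<close>-Bessel series\<close>

text \<open>The Stieltjes--Wigert polynomials. They build up the factor \<open>q ^ k\<^sup>2 / (q;q)\<^sub>k\<close> of the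
  coefficients in the limit; \<open>l\<close> scales the variable.\<close>
primrec stieltjes_wigert :: "real \<Rightarrow> real \<Rightarrow> nat \<Rightarrow> real poly" where
  "stieltjes_wigert q l 0 = 1"
| "stieltjes_wigert q l (Suc N) = stieltjes_wigert q l N
     - [:0, l * q ^ Suc N:] * pcompose (stieltjes_wigert q l N) [:0, q:]"

text \<open>Each step multiplies the \<open>k\<close>-th coefficient by \<open>1 - a * q ^ (j + k)\<close>. Relative to the constant
  coefficient, the product of these factors tends to \<open>1 / (a;q)\<^sub>k\<close>, so the Pochhammer symbol in
  the denominator is produced by operators that preserve separation.\<close>
primrec q_damped :: "real \<Rightarrow> real \<Rightarrow> real poly \<Rightarrow> nat \<Rightarrow> real poly" where
  "q_damped q a p 0 = p"
| "q_damped q a p (Suc j) = q_damped q a p j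
     - [:a * q ^ j, 0:] * pcompose (q_damped q a p j) [:0, q:]"

lemma separated_roots_stieltjes_wigert:
  assumes "0 < q" "q < 1" "0 \<le> l"
  shows "separated_roots q (stieltjes_wigert q l N)"
proof (induction N)
  case 0
  have "separated_roots q 1"
    unfolding separated_roots_def by (auto intro!: exI[of _ "0::nat"])
  then show ?case by simp
next
  case (Suc N)
  then show ?case using separated_roots_step[of q 0 "l * q ^ Suc N"] assms by simp
qed

lemma separated_roots_q_damped:
  assumes "0 < q" "q < 1" "0 \<le> a" "a < 1" "separated_roots q p"
  shows "separated_roots q (q_damped q a p M)"
proof (induction M)
  case (Suc M)
  have "a * q ^ M \<le> a * 1" using assms by (intro mult_left_mono power_le_one) auto
  then show ?case
    using separated_roots_step[of q "a * q ^ M" 0 "q_damped q a p M"] Suc assms by simp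
qed (use assms in simp)

text \<open>The product of the \<open>1 - q ^ (N - i)\<close> over \<open>(q;q)\<^sub>k\<close> is the Gaussian binomial coefficient. In this
  form it is also right for \<open>k > N\<close>, because the factor for \<open>i = N\<close> is zero; the recursion is
  the \<open>q\<close>-Pascal rule.\<close>
lemma coeff_stieltjes_wigert:
  assumes "0 < q" "q < 1"
  shows "coeff (stieltjes_wigert q l N) k
    = (- l) ^ k * q ^ k\<^sup>2 * (\<Prod>i<k. 1 - q ^ (N - i)) / qpoch q q k"
proof (induction N arbitrary: k)
  case 0
  show ?case
  proof (cases k)
    case (Suc m)
    have "(\<Prod>i<k. 1 - q ^ (0 - i)) = 0" using Suc by (intro prod_zero bexI[of _ 0]) auto
    then show ?thesis using Suc by simp
  qed (simp add: qpoch_def)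
next
  case (Suc N)
  show ?case
  proof (cases k)
    case 0
    then show ?thesis by (simp add: Suc.IH qpoch_def)
  next
    case (Suc m)
    define R where "R = (\<Prod>i<m. 1 - q ^ (N - i))"
    have top: "(\<Prod>i<Suc m. 1 - q ^ (Suc N - i)) = (1 - q ^ Suc N) * R"
      unfolding R_def by (subst prod.lessThan_Suc_shift) simp
    have nz: "qpoch q q m \<noteq> 0" "1 - q * q ^ m \<noteq> 0"
      using qpoch_nonzero[of q q m] qpoch_nonzero[of q q "Suc m"] assms by (auto simp: qpoch_Suc)
    have sq: "q ^ (Suc m)\<^sup>2 = q ^ m\<^sup>2 * q ^ (2 * m + 1)"
    proof -
      have "(Suc m)\<^sup>2 = m\<^sup>2 + (2 * m + 1)" by (simp add: power2_eq_square)
      then show ?thesis by (simp only: power_add)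
    qed
    have R: "R * (q ^ (2 * m + 1) * (1 - q ^ (N - m)) + q ^ Suc N * q ^ m * (1 - q * q ^ m))
        = R * (q ^ (2 * m + 1) * (1 - q ^ Suc N))"
    proof (cases "m \<le> N")
      case True
      then obtain d where "N = m + d" using le_Suc_ex by blast
      then show ?thesis by (simp add: algebra_simps power_add power_mult power2_eq_square mult_2)
    next
      case False
      then have "R = 0" unfolding R_def by (intro prod_zero bexI[of _ N]) auto
      then show ?thesis by simp
    qed
    have "coeff (stieltjes_wigert q l (Suc N)) k
        = coeff (stieltjes_wigert q l N) (Suc m)
          - l * q ^ Suc N * (q ^ m * coeff (stieltjes_wigert q l N) m)"
      using Suc by (simp add: coeff_pcompose_linear algebra_simps)
    also have "\<dots> = (- l) ^ Suc m * q ^ m\<^sup>2 *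
        (R * (q ^ (2 * m + 1) * (1 - q ^ (N - m)) + q ^ Suc N * q ^ m * (1 - q * q ^ m)))
        / qpoch q q (Suc m)"
      unfolding Suc.IH sq qpoch_Suc prod.lessThan_Suc R_def[symmetric]
      using nz by (simp add: field_simps)
    also have "\<dots> = (- l) ^ k * q ^ k\<^sup>2 * (\<Prod>i<k. 1 - q ^ (Suc N - i)) / qpoch q q k"
      unfolding R Suc top sq by (simp add: mult_ac)
    finally show ?thesis .
  qed
qed

lemma coeff_q_damped:
  "coeff (q_damped q a p M) k = coeff p k * (\<Prod>j<M. 1 - a * q ^ (j + k))"
  by (induction M) (simp_all add: coeff_pcompose_linear power_add algebra_simps)

lemma qpoch_add: "qpoch a q (m + n) = qpoch a q m * (\<Prod>j<n. 1 - a * q ^ (j + m))"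
  by (induction n) (simp_all add: qpoch_Suc add_ac qpoch_def[of _ _ 0])

section \<open>Power sums of the reciprocal zeros\<close>

text \<open>Newton's identities for a polynomial or power series with coefficients \<open>c\<close>. The index is
  shifted by one: \<open>s k\<close> is the sum of the powers of order \<open>k + 1\<close> of the reciprocal zeros, since
  the sum of order \<open>0\<close> counts the zeros and does not converge. With this shift the identities say
  that \<open>- f' / f\<close> has the coefficients \<open>s\<close>.\<close>
definition newton_sums :: "(nat \<Rightarrow> real) \<Rightarrow> (nat \<Rightarrow> real) \<Rightarrow> bool" where
  "newton_sums c s \<longleftrightarrow> (\<forall>n. real (Suc n) * c (Suc n) = - (\<Sum>i\<le>n. s i * c (n - i)))"

lemma newton_sums_fps:
  "newton_sums c s \<longleftrightarrow> fps_deriv (Abs_fps c) = - (Abs_fps s * Abs_fps c)"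
  by (simp add: newton_sums_def fps_eq_iff fps_mult_nth atLeast0AtMost add_ac)

text \<open>The logarithmic derivative is additive, and one factor \<open>1 - u x\<close> contributes the geometric
  series \<open>u / (1 - u x)\<close>.\<close>
lemma newton_sums_prod:
  fixes n :: nat
  shows
  "newton_sums (coeff (\<Prod>i<n. [:1, - u i:])) (\<lambda>k. \<Sum>i<n. u i ^ Suc k)"
proof (induction n)
  case 0
  then show ?case by (simp add: newton_sums_def)
next
  case (Suc n)
  let ?p = "\<Prod>i<n. [:1, - u i:]"
  let ?F = "Abs_fps (coeff ?p)" and ?S = "Abs_fps (\<lambda>k. \<Sum>i<n. u i ^ Suc k)"
  let ?U = "Abs_fps (\<lambda>k. u n ^ Suc k)" and ?L = "1 - fps_const (u n) * fps_X :: real fps"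
  have S: "Abs_fps (\<lambda>k. \<Sum>i<Suc n. u i ^ Suc k) = ?S + ?U"
    by (simp add: fps_eq_iff)
  have F: "Abs_fps (coeff (\<Prod>i<Suc n. [:1, - u i:])) = ?F * ?L"
    by (simp add: fps_eq_iff algebra_simps mult.commute[of _ fps_X]
        mult.left_commute[of _ fps_X] coeff_pCons split: nat.splits)
  have U: "?U * ?L = fps_const (u n)"
  proof (rule fps_ext)
    fix k
    show "fps_nth (?U * ?L) k = fps_nth (fps_const (u n)) k"
      by (cases k) (simp_all add: algebra_simps mult.commute[of _ fps_X]
          mult.left_commute[of _ fps_X])
  qed
  have "fps_deriv (?F * ?L) = fps_deriv ?F * ?L - fps_const (u n) * ?F"
    by (simp add: algebra_simps)
  also have "\<dots> = - (?S * ?F) * ?L - (?U * ?L) * ?F"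
    using Suc unfolding newton_sums_fps U by simp
  also have "\<dots> = - ((?S + ?U) * (?F * ?L))"
    by (simp add: algebra_simps)
  finally show ?case unfolding newton_sums_fps S F .
qed

text \<open>What remains of a function with positive zeros when only limits of power sums are known: \<open>u\<close>
  stands for the largest reciprocal of a zero and \<open>s k\<close> for the sum of the powers \<open>k + 1\<close> of the
  reciprocals. The first inequality keeps only the largest term. The others come from \<open>t \<le> u\<close> and
  \<open>t * (u - t) \<le> u * (u - t)\<close>, multiplied by a power of \<open>t\<close> and summed over the reciprocals \<open>t\<close>;
  the last one carries strictness from one power sum to the next. All clauses are closed under
  limits.\<close>
definition root_moments :: "(nat \<Rightarrow> real) \<Rightarrow> real \<Rightarrow> (nat \<Rightarrow> real) \<Rightarrow> bool" where
  "root_moments c u s \<longleftrightarrow> 0 \<le> u \<and> newton_sums c s \<and> (\<forall>k. u ^ Suc k \<le> s k) \<and>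
     (\<forall>k. s (Suc k) \<le> u * s k) \<and>
     (\<forall>k. u * s (Suc k) - s (Suc (Suc k)) \<le> u * (u * s k - s (Suc k)))"

lemma simple_positive_roots_moments:
  assumes "simple_positive_roots p" "poly p 0 = 1"
  shows "\<exists>u s. root_moments (coeff p) u s"
proof -
  obtain n x where x: "\<And>i. i < n \<Longrightarrow> 0 < x i" "\<And>i. Suc i < n \<Longrightarrow> x i < x (Suc i)"
    and p: "p = (\<Prod>i<n. [:1, - (1 / x i):])"
    using assms unfolding simple_positive_roots_def by auto
  define s where "s k = (\<Sum>i<n. (1 / x i) ^ Suc k)" for k
  have newton: "newton_sums (coeff p) s"
    unfolding p s_def by (rule newton_sums_prod)
  define u where "u = (if n = 0 then 0 else 1 / x 0)"
  have u0: "0 \<le> u" using x(1)[of 0] by (simp add: u_def less_imp_le)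
  have ui: "1 / x i \<le> u" "0 \<le> 1 / x i" if "i < n" for i
  proof -
    have "x 0 \<le> x i" using increasing_below[of n x 0 i] x(2) that by (cases i) (auto simp: less_imp_le)
    then show "1 / x i \<le> u" using that x(1)[of 0] x(1)[of i] by (auto simp: u_def frac_le)
    show "0 \<le> 1 / x i" using x(1)[OF that] by simp
  qed
  have 1: "u ^ Suc k \<le> s k" for k
  proof (cases "n = 0")
    case False
    have "(1 / x 0) ^ Suc k \<le> (\<Sum>i<n. (1 / x i) ^ Suc k)"
      using False ui by (intro member_le_sum[of 0 "{..<n}" "\<lambda>i. (1 / x i) ^ Suc k"] zero_le_power) auto
    then show ?thesis using False by (simp add: u_def s_def)
  qed (simp add: u_def s_def)
  have 2: "s (Suc k) \<le> u * s k" for k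
    unfolding s_def sum_distrib_left
  proof (rule sum_mono)
    fix i assume "i \<in> {..<n}"
    then show "(1 / x i) ^ Suc (Suc k) \<le> u * (1 / x i) ^ Suc k"
      using ui[of i] by (subst power_Suc, intro mult_right_mono zero_le_power) auto
  qed
  have 3: "u * s (Suc k) - s (Suc (Suc k)) \<le> u * (u * s k - s (Suc k))" for k
    unfolding s_def sum_distrib_left sum_subtractf[symmetric]
  proof (rule sum_mono)
    fix i assume i: "i \<in> {..<n}"
    define v where "v = 1 / x i"
    have v: "0 \<le> v" "v \<le> u" using ui[of i] i by (auto simp: v_def)
    have "v * (v ^ Suc k * (u - v)) \<le> u * (v ^ Suc k * (u - v))"
      using v by (intro mult_right_mono mult_nonneg_nonneg zero_le_power) auto
    then show "u * (1 / x i) ^ Suc (Suc k) - (1 / x i) ^ Suc (Suc (Suc k))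
        \<le> u * (u * (1 / x i) ^ Suc k - (1 / x i) ^ Suc (Suc k))"
      unfolding v_def[symmetric] by (simp add: algebra_simps)
  qed
  show ?thesis unfolding root_moments_def using u0 newton 1 2 3 by blast
qed

text \<open>Newton's identities determine the power sums recursively from the coefficients, so these
  converge. The largest reciprocals are bounded by the first power sums, and a convergent
  subsequence supplies \<open>v\<close>. This replaces the Hadamard factorization of the limit.\<close>
lemma root_moments_limit:
  assumes m: "\<And>N. root_moments (c N) (u N) (s N)"
    and c0: "\<And>N. c N 0 = 1" and lim: "\<And>k. (\<lambda>N. c N k) \<longlonglongrightarrow> C k"
  shows "\<exists>v S. root_moments C v S"
proof -
  have newton: "real (Suc n) * c N (Suc n) = - (\<Sum>i\<le>n. s N i * c N (n - i))" for N n
    using m[of N] by (auto simp: root_moments_def newton_sums_def)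
  have conv: "convergent (\<lambda>N. s N n)" for n
  proof (induction n rule: less_induct)
    case (less n)
    have "s N n = - (real (Suc n) * c N (Suc n)) - (\<Sum>i<n. s N i * c N (n - i))" for N
      using newton[of n N] c0[of N] by (simp add: lessThan_Suc_atMost[symmetric])
    moreover have "convergent (\<lambda>N. - (real (Suc n) * c N (Suc n)) - (\<Sum>i<n. s N i * c N (n - i)))"
    proof (intro convergent_diff convergent_sum convergent_mult convergent_const
        convergent_minus_iff[THEN iffD1])
      show "convergent (\<lambda>N. c N (Suc n))" "convergent (\<lambda>N. c N (n - i))" for i
        using lim convergentI by blast+
    qed (use less in auto)
    ultimately show ?case by presburger
  qed
  define S where "S n = lim (\<lambda>N. s N n)" for n
  have Slim: "(\<lambda>N. s N n) \<longlonglongrightarrow> S n" for n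
    using conv[of n] by (simp add: S_def convergent_LIMSEQ_iff)
  have b: "0 \<le> u N" "u N ^ Suc k \<le> s N k" "s N (Suc k) \<le> u N * s N k"
      "u N * s N (Suc k) - s N (Suc (Suc k)) \<le> u N * (u N * s N k - s N (Suc k))" for N k
    using m[of N] unfolding root_moments_def by blast+
  obtain K where K: "\<And>N. norm (s N 0) \<le> K"
    using convergent_imp_Bseq[OF conv[of 0]] unfolding Bseq_def by blast
  have "norm (u N) \<le> K" for N using b(1)[of N] b(2)[of N 0] K[of N] by simp
  then have "bounded (range u)" unfolding bounded_iff by blast
  then obtain v r where r: "strict_mono r" "(u \<circ> r) \<longlonglongrightarrow> v"
    using bounded_imp_convergent_subsequence by blast
  have u: "(\<lambda>N. u (r N)) \<longlonglongrightarrow> v" using r(2) by (simp add: o_def)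
  have sr: "(\<lambda>N. s (r N) k) \<longlonglongrightarrow> S k" for k
    using LIMSEQ_subseq_LIMSEQ[OF Slim r(1)] by (simp add: o_def)
  have "0 \<le> v" using u b(1) by (intro LIMSEQ_le_const[OF u]) auto
  moreover have "newton_sums C S"
    unfolding newton_sums_def
  proof
    fix n
    have "(\<lambda>N. real (Suc n) * c N (Suc n)) \<longlonglongrightarrow> real (Suc n) * C (Suc n)"
      by (intro tendsto_intros lim)
    moreover have "(\<lambda>N. - (\<Sum>i\<le>n. s N i * c N (n - i))) \<longlonglongrightarrow> - (\<Sum>i\<le>n. S i * C (n - i))"
      by (intro tendsto_intros lim Slim)
    ultimately show "real (Suc n) * C (Suc n) = - (\<Sum>i\<le>n. S i * C (n - i))"
      unfolding newton using LIMSEQ_unique by blast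
  qed
  moreover have "v ^ Suc k \<le> S k" for k
    using b(2) by (intro LIMSEQ_le[OF tendsto_power[OF u] sr]) auto
  moreover have "S (Suc k) \<le> v * S k" for k
    using b(3) by (intro LIMSEQ_le[OF sr tendsto_mult[OF u sr]]) auto
  moreover have "v * S (Suc k) - S (Suc (Suc k)) \<le> v * (v * S k - S (Suc k))" for k
  proof (rule LIMSEQ_le)
    show "(\<lambda>N. u (r N) * s (r N) (Suc k) - s (r N) (Suc (Suc k))) \<longlonglongrightarrow> v * S (Suc k) - S (Suc (Suc k))"
      by (intro tendsto_intros u sr)
    show "(\<lambda>N. u (r N) * (u (r N) * s (r N) k - s (r N) (Suc k))) \<longlonglongrightarrow> v * (v * S k - S (Suc k))"
      by (intro tendsto_intros u sr)
  qed (use b(4) in auto)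
  ultimately show ?thesis unfolding root_moments_def by blast
qed

lemma simple_positive_roots_smult:
  assumes "simple_positive_roots p" "0 < c"
  shows "simple_positive_roots (smult c p)"
proof -
  obtain n x where x: "\<forall>i<n. 0 < x i" "\<forall>i. Suc i < n \<longrightarrow> x i < x (Suc i)"
    and p: "p = smult (poly p 0) (\<Prod>i<n. [:1, - 1 / x i:])" and p0: "0 < poly p 0"
    using assms unfolding simple_positive_roots_def by blast
  have "smult c p = smult (poly (smult c p) 0) (\<Prod>i<n. [:1, - 1 / x i:])"
    using arg_cong[OF p, of "smult c"] unfolding smult_smult poly_smult .
  moreover have "0 < poly (smult c p) 0" using p0 assms(2) by simp
  ultimately show ?thesis unfolding simple_positive_roots_def using x by blast
qed

section \<open>Power sums for \<open>h'\<close> and \<open>(z h')'\<close>\<close>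

text \<open>Both \<open>h'\<close> and \<open>(z h')'\<close> are limits of polynomials with simple positive zeros.\<close>
lemma h2_coeff_root_moments:
  assumes "\<nu> > - 1" "0 < q" "q < 1"
  shows "\<exists>u s. root_moments (\<lambda>n. real (Suc n) * h2_coeff \<nu> q n) u s"
    and "\<exists>u s. root_moments (\<lambda>n. (real (Suc n))\<^sup>2 * h2_coeff \<nu> q n) u s"
proof -
  define a where "a = q powr (\<nu> + 1)"
  have a: "0 < a" "a < 1"
    using assms powr_less_mono2[of "\<nu> + 1" q 1] by (auto simp: a_def)
  define l where "l = q powr \<nu> / 4"
  define A where "A N = q_damped q a (stieltjes_wigert q l N) N" for N
  have nz: "qpoch a q n \<noteq> 0" "qpoch q q n \<noteq> 0" for n
    using qpoch_nonzero assms a by auto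
  have c: "coeff (A N) k = ((- l) ^ k * q ^ k\<^sup>2 * (\<Prod>i<k. 1 - q ^ (N - i)) / qpoch q q k)
      * (\<Prod>i<k. 1 - a * q ^ (i + N)) / qpoch a q k * qpoch a q N" for N k
  proof -
    have "(\<Prod>j<N. 1 - a * q ^ (j + k)) * qpoch a q k = qpoch a q N * (\<Prod>i<k. 1 - a * q ^ (i + N))"
      using qpoch_add[of a q N k] qpoch_add[of a q k N] by (simp add: add.commute mult.commute)
    then have "(\<Prod>j<N. 1 - a * q ^ (j + k)) = (\<Prod>i<k. 1 - a * q ^ (i + N)) / qpoch a q k * qpoch a q N"
      using nz by (simp add: field_simps)
    then show ?thesis
      unfolding A_def coeff_q_damped coeff_stieltjes_wigert[OF assms(2,3)] by simp
  qed
  have c0: "coeff (A N) 0 = qpoch a q N" for N by (simp add: c qpoch_def[of _ _ 0])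
  have "separated_roots q (A N)" for N
    unfolding A_def using assms a
    by (intro separated_roots_q_damped separated_roots_stieltjes_wigert) (auto simp: l_def)
  then have sA: "simple_positive_roots (A N)" for N
    using separated_imp_simple assms by blast
  then have pos: "0 < qpoch a q N" for N
    using c0[of N] sA[of N] by (simp add: simple_positive_roots_def poly_0_coeff_0)
  define B where "B N = pderiv (pCons 0 (smult (1 / qpoch a q N) (A N)))" for N
  have sB: "simple_positive_roots (B N)" for N
    unfolding B_def using pos sA by (intro simple_roots_Rolle simple_positive_roots_smult) auto
  have p0: "(\<lambda>N. q ^ (N - i)) \<longlonglongrightarrow> 0" for i
    by (rule LIMSEQ_offset[of _ i]) (use assms in \<open>auto intro!: LIMSEQ_realpow_zero\<close>)
  have p1: "(\<lambda>N. q ^ (i + N)) \<longlonglongrightarrow> 0" for i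
    using LIMSEQ_ignore_initial_segment[of "\<lambda>N. q ^ N" 0 i] assms
    by (simp add: LIMSEQ_realpow_zero add.commute)
  have lim: "(\<lambda>N. coeff (smult (1 / qpoch a q N) (A N)) k) \<longlonglongrightarrow> h2_coeff \<nu> q k" for k
  proof -
    have "(\<lambda>N. ((- l) ^ k * q ^ k\<^sup>2 * (\<Prod>i<k. 1 - q ^ (N - i)) / qpoch q q k)
      * (\<Prod>i<k. 1 - a * q ^ (i + N)) / qpoch a q k)
      \<longlonglongrightarrow> ((- l) ^ k * q ^ k\<^sup>2 * (\<Prod>i<k. 1 - 0) / qpoch q q k)
      * (\<Prod>i<k. 1 - a * 0) / qpoch a q k"
      using nz by (intro tendsto_intros p0 p1) auto
    also have "((- l) ^ k * q ^ k\<^sup>2 * (\<Prod>i<k. 1 - 0) / qpoch q q k)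
      * (\<Prod>i<k. 1 - a * 0) / qpoch a q k = h2_coeff \<nu> q k"
    proof -
      have "q powr (real k * (real k + \<nu>)) = q powr (real (k\<^sup>2)) * (q powr \<nu>) powr (real k)"
        by (simp add: powr_powr powr_add[symmetric] algebra_simps power2_eq_square)
      also have "\<dots> = q ^ k\<^sup>2 * (q powr \<nu>) ^ k"
        using assms by (simp add: powr_realpow del: of_nat_power)
      finally show ?thesis
        by (simp add: h2_coeff_def a_def l_def power_divide power_minus[of "q powr \<nu> / 4"])
    qed
    finally show ?thesis using nz by (simp add: c)
  qed
  have B: "coeff (B N) k = real (Suc k) * coeff (smult (1 / qpoch a q N) (A N)) k" for N k
    by (simp add: B_def coeff_pderiv)
  have B2: "coeff (pderiv (pCons 0 (B N))) k
      = (real (Suc k))\<^sup>2 * coeff (smult (1 / qpoch a q N) (A N)) k" for N k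
    by (simp add: B[of N k] coeff_pderiv power2_eq_square mult.assoc del: of_nat_Suc)
  have B0: "poly (B N) 0 = 1" for N
    using nz by (simp add: poly_0_coeff_0 B c0)
  have B20: "poly (pderiv (pCons 0 (B N))) 0 = 1" for N
    using nz by (simp add: poly_0_coeff_0 B2 c0)
  obtain u s where us: "\<And>N. root_moments (coeff (B N)) (u N) (s N)"
    using simple_positive_roots_moments[OF sB B0] by metis
  show "\<exists>u s. root_moments (\<lambda>n. real (Suc n) * h2_coeff \<nu> q n) u s"
  proof (rule root_moments_limit[OF us])
    show "(\<lambda>N. coeff (B N) k) \<longlonglongrightarrow> real (Suc k) * h2_coeff \<nu> q k" for k
      unfolding B by (intro tendsto_intros lim)
  qed (use B0 in \<open>simp add: poly_0_coeff_0\<close>)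
  obtain u s where us: "\<And>N. root_moments (coeff (pderiv (pCons 0 (B N)))) (u N) (s N)"
    using simple_positive_roots_moments[OF simple_roots_Rolle[OF sB] B20] by metis
  show "\<exists>u s. root_moments (\<lambda>n. (real (Suc n))\<^sup>2 * h2_coeff \<nu> q n) u s"
  proof (rule root_moments_limit[OF us])
    show "(\<lambda>N. coeff (pderiv (pCons 0 (B N))) k) \<longlonglongrightarrow> (real (Suc k))\<^sup>2 * h2_coeff \<nu> q k" for k
      unfolding B2 by (intro tendsto_intros lim)
  qed (use B20 in \<open>simp add: poly_0_coeff_0\<close>)
qed

section \<open>Entire power series and their first positive zero\<close>

definition pseries :: "(nat \<Rightarrow> real) \<Rightarrow> 'a \<Rightarrow> 'a::{banach, real_normed_field}" where
  "pseries c z = (\<Sum>n. of_real (c n) * z ^ n)"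

definition entire_coeffs :: "(nat \<Rightarrow> real) \<Rightarrow> bool" where
  "entire_coeffs c \<longleftrightarrow> (\<forall>x. summable (\<lambda>n. c n * x ^ n))"

lemma entire_norm_summable:
  fixes z :: "'a::{banach, real_normed_field}"
  assumes "entire_coeffs c"
  shows "summable (\<lambda>n. norm (of_real (c n) * z ^ n))"
proof -
  have "summable (\<lambda>n. c n * (norm z + 1) ^ n)" using assms by (simp add: entire_coeffs_def)
  then have "summable (\<lambda>n. norm (c n * norm z ^ n))"
    by (rule powser_insidea) simp
  then show ?thesis by (simp add: norm_mult norm_power abs_mult power_abs)
qed

lemma entire_summable:
  fixes z :: "'a::{banach, real_normed_field}"
  assumes "entire_coeffs c"
  shows "summable (\<lambda>n. of_real (c n) * z ^ n)"
  using entire_norm_summable[OF assms] by (rule summable_norm_cancel)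

lemma entire_diffs: "entire_coeffs c \<Longrightarrow> entire_coeffs (diffs c)"
  unfolding entire_coeffs_def by (blast intro: termdiff_converges_all)

lemma diffs_of_real: "diffs (\<lambda>n. of_real (c n)) = (\<lambda>n. of_real (diffs c n) :: 'a::real_normed_field)"
  by (simp add: diffs_def fun_eq_iff)

lemma pseries_deriv:
  fixes z :: "'a::{banach, real_normed_field}"
  assumes "entire_coeffs c"
  shows "(pseries c has_field_derivative pseries (diffs c) z) (at z)"
  using termdiffs_strong_converges_everywhere[OF entire_summable[OF assms], of z]
  unfolding diffs_of_real pseries_def[abs_def] .

lemma pseries_of_real:
  assumes "entire_coeffs c"
  shows "pseries c (of_real x :: 'a::{banach, real_normed_field}) = of_real (pseries c x)"
proof -
  have "summable (\<lambda>n. c n * x ^ n)" using assms by (simp add: entire_coeffs_def)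
  then have "(of_real (\<Sum>n. c n * x ^ n) :: 'a) = (\<Sum>n. of_real (c n * x ^ n))"
    by (rule suminf_of_real)
  then show ?thesis by (simp add: pseries_def)
qed

lemma pseries_0: "pseries c 0 = of_real (c 0)"
  using powser_zero[of "\<lambda>n. of_real (c n)"] by (simp add: pseries_def)

lemma pseries_Euler:
  fixes z :: "'a::{banach, real_normed_field}"
  assumes "entire_coeffs c"
  shows "pseries (\<lambda>n. real (Suc n) * c n) z = pseries c z + z * pseries (diffs c) z"
proof -
  have "summable (\<lambda>n. diffs (\<lambda>n. of_real (c n)) n * z ^ n)"
    unfolding diffs_of_real by (intro entire_summable entire_diffs assms)
  from sums_mult[OF diffs_equiv[OF this], of z]
  have "(\<lambda>n. z * (of_nat n * of_real (c n) * z ^ (n - Suc 0))) sums (z * pseries (diffs c) z)"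
    unfolding diffs_of_real pseries_def .
  also have "(\<lambda>n. z * (of_nat n * of_real (c n) * z ^ (n - Suc 0))) = (\<lambda>n. of_nat n * of_real (c n) * z ^ n)"
  proof
    show "z * (of_nat n * of_real (c n) * z ^ (n - Suc 0)) = of_nat n * of_real (c n) * z ^ n" for n
      by (cases n) auto
  qed
  finally have 1: "(\<lambda>n. of_nat n * of_real (c n) * z ^ n) sums (z * pseries (diffs c) z)" .
  have "(\<lambda>n. of_real (c n) * z ^ n) sums pseries c z"
    unfolding pseries_def by (intro summable_sums entire_summable assms)
  from sums_add[OF this 1]
  have "(\<lambda>n. of_real (real (Suc n) * c n) * z ^ n) sums (pseries c z + z * pseries (diffs c) z)"
    by (simp add: algebra_simps)
  then show ?thesis unfolding pseries_def by (rule sums_unique[symmetric])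
qed

lemma entire_Euler:
  assumes "entire_coeffs c"
  shows "entire_coeffs (\<lambda>n. real (Suc n) * c n)"
  unfolding entire_coeffs_def
proof
  fix x :: real
  have c: "summable (\<lambda>n. c n * x ^ n)" and d: "summable (\<lambda>n. diffs c n * x ^ n)"
    using assms entire_diffs[OF assms] by (auto simp: entire_coeffs_def)
  have "summable (\<lambda>n. x * (of_nat n * c n * x ^ (n - Suc 0)))"
    using sums_summable[OF diffs_equiv[OF d]] by (rule summable_mult)
  also have "(\<lambda>n. x * (of_nat n * c n * x ^ (n - Suc 0))) = (\<lambda>n. of_nat n * c n * x ^ n)"
  proof
    show "x * (of_nat n * c n * x ^ (n - Suc 0)) = of_nat n * c n * x ^ n" for n
      by (cases n) auto
  qed
  finally have "summable (\<lambda>n. c n * x ^ n + of_nat n * c n * x ^ n)"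
    by (rule summable_add[OF c])
  then show "summable (\<lambda>n. real (Suc n) * c n * x ^ n)"
    by (simp add: algebra_simps)
qed

lemma root_moments_nonneg:
  assumes "root_moments c u s"
  shows "0 \<le> s k"
  using assms order_trans[of 0 "u ^ Suc k" "s k"] by (simp add: root_moments_def)

lemma root_moments_le:
  assumes "root_moments c u s"
  shows "s k \<le> s 0 * u ^ k"
proof (induction k)
  case (Suc k)
  have "s (Suc k) \<le> u * s k" using assms by (simp add: root_moments_def)
  also have "\<dots> \<le> u * (s 0 * u ^ k)"
    using Suc assms by (intro mult_left_mono) (auto simp: root_moments_def)
  finally show ?case by (simp add: mult_ac)
qed simp

lemma moments_norm_summable:
  fixes z :: "'a::{banach, real_normed_field}"
  assumes m: "root_moments c u s" and "u * norm z < 1"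
  shows "summable (\<lambda>k. norm (of_real (s k) * z ^ k))"
proof (rule summable_comparison_test')
  have "0 \<le> u" using m by (simp add: root_moments_def)
  then show "summable (\<lambda>k. s 0 * (u * norm z) ^ k)"
    using assms(2) by (intro summable_mult summable_geometric) auto
  show "norm (norm (of_real (s k) * z ^ k)) \<le> s 0 * (u * norm z) ^ k" if "k \<ge> 0" for k
  proof -
    have "s k * norm z ^ k \<le> (s 0 * u ^ k) * norm z ^ k"
      using root_moments_le[OF m] by (intro mult_right_mono) auto
    then show ?thesis
      using root_moments_nonneg[OF m] by (simp add: norm_mult norm_power power_mult_distrib mult.assoc)
  qed
qed

text \<open>Newton's identities turned from coefficients into an identity of functions, valid where the
  series of power sums converges.\<close>
lemma pseries_log_deriv:
  fixes z :: "'a::{banach, real_normed_field}"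
  assumes e: "entire_coeffs c" and m: "root_moments c u s" and z: "u * norm z < 1"
  shows "pseries (diffs c) z = - (pseries s z * pseries c z)"
proof -
  have "pseries s z * pseries c z
      = (\<Sum>k. \<Sum>i\<le>k. (of_real (s i) * z ^ i) * (of_real (c (k - i)) * z ^ (k - i)))"
    unfolding pseries_def
    by (rule Cauchy_product[OF moments_norm_summable[OF m z] entire_norm_summable[OF e]])
  also have "\<dots> = (\<Sum>k. - (of_real (diffs c k) * z ^ k))"
  proof (rule arg_cong[where f = suminf], rule ext)
    fix k
    have "(\<Sum>i\<le>k. (of_real (s i) * z ^ i) * (of_real (c (k - i)) * z ^ (k - i)))
        = (\<Sum>i\<le>k. of_real (s i * c (k - i)) * z ^ k)"
    proof (rule sum.cong)
      fix i assume "i \<in> {..k}"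
      then have "z ^ k = z ^ i * z ^ (k - i)" by (simp add: power_add[symmetric])
      then show "(of_real (s i) * z ^ i) * (of_real (c (k - i)) * z ^ (k - i))
          = of_real (s i * c (k - i)) * z ^ k" by simp
    qed simp
    also have "\<dots> = of_real (\<Sum>i\<le>k. s i * c (k - i)) * z ^ k"
      by (simp add: sum_distrib_right)
    also have "(\<Sum>i\<le>k. s i * c (k - i)) = - diffs c k"
    proof -
      have "real (Suc k) * c (Suc k) = - (\<Sum>i\<le>k. s i * c (k - i))"
        using m by (simp only: root_moments_def newton_sums_def)
      then show ?thesis by (simp add: diffs_def)
    qed
    finally show "(\<Sum>i\<le>k. (of_real (s i) * z ^ i) * (of_real (c (k - i)) * z ^ (k - i)))
        = - (of_real (diffs c k) * z ^ k)" by simp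
  qed
  also have "\<dots> = - pseries (diffs c) z"
    unfolding pseries_def by (rule suminf_minus[OF entire_summable[OF entire_diffs[OF e]]])
  finally show ?thesis by simp
qed

text \<open>Integrating the logarithmic derivative shows that \<open>f\<close> is an exponential on \<open>|z| < 1 / u\<close>. Over
  the complex numbers this says that \<open>f\<close> has no zero there, over the reals that it is positive.\<close>
lemma pseries_eq_exp:
  fixes z :: "'a::{banach, real_normed_field}"
  assumes e: "entire_coeffs c" and m: "root_moments c u s" and c0: "c 0 = 1"
    and z: "u * norm z < 1"
  shows "\<exists>w. pseries c z = exp w"
proof -
  have u: "0 \<le> u" using m by (simp add: root_moments_def)
  obtain K :: real where K: "norm z < K" "u * K < 1"
  proof (cases "u = 0")
    case True
    then show ?thesis using that[of "norm z + 1"] by simp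
  next
    case False
    then have "norm z < 1 / u" using z u by (simp add: pos_less_divide_eq mult.commute)
    then obtain K where "norm z < K" "K < 1 / u" using dense by blast
    then show ?thesis using that[of K] u False by (simp add: pos_less_divide_eq mult.commute)
  qed
  have K0: "0 < K" using K(1) norm_ge_zero[of z] by linarith
  define t :: "nat \<Rightarrow> 'a" where "t n = (case n of 0 \<Rightarrow> 0 | Suc k \<Rightarrow> of_real (s k / real (Suc k)))" for n
  have dt: "diffs t = (\<lambda>k. of_real (s k))"
    by (simp add: diffs_def t_def fun_eq_iff del: of_nat_Suc of_real_divide)
       (simp add: nonzero_of_real_divide del: of_nat_Suc)
  have "summable (\<lambda>n. t n * of_real K ^ n)"
  proof (subst summable_Suc_iff[symmetric], rule summable_comparison_test')
    have "summable (\<lambda>k. norm (of_real (s k) * (of_real K :: 'a) ^ k))"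
      using K K0 by (intro moments_norm_summable[OF m]) auto
    then show "summable (\<lambda>k. K * norm (of_real (s k) * (of_real K :: 'a) ^ k))"
      by (rule summable_mult)
    show "norm (t (Suc k) * of_real K ^ Suc k) \<le> K * norm (of_real (s k) * (of_real K :: 'a) ^ k)"
      if "k \<ge> 0" for k
    proof -
      have "s k / real (Suc k) \<le> s k"
        using root_moments_nonneg[OF m, of k] by (simp add: divide_le_eq mult_le_cancel_left1 del: of_nat_Suc)
      then have "s k / real (Suc k) * K ^ Suc k \<le> s k * K ^ Suc k"
        using K0 by (intro mult_right_mono) auto
      then show ?thesis
        using K0 root_moments_nonneg[OF m, of k]
        by (simp add: t_def norm_mult norm_power norm_divide mult_ac del: of_nat_Suc of_real_divide)
    qed
  qed
  then have dT: "((\<lambda>x. \<Sum>n. t n * x ^ n) has_field_derivative pseries s x) (at x)"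
    if "norm x < K" for x
    using termdiffs_strong[of t "of_real K" x] that K0 by (simp add: dt pseries_def)
  let ?T = "\<lambda>x. \<Sum>n. t n * x ^ n"
  have "\<exists>k. \<forall>x\<in>ball 0 K. pseries c x * exp (?T x) = k"
  proof (rule has_field_derivative_zero_constant)
    fix x :: 'a assume "x \<in> ball 0 K"
    then have x: "norm x < K" by simp
    then have "u * norm x \<le> u * K" using u by (intro mult_left_mono) auto
    then have ux: "u * norm x < 1" using K by linarith
    have "((\<lambda>x. pseries c x * exp (?T x)) has_field_derivative
        pseries (diffs c) x * exp (?T x) + exp (?T x) * pseries s x * pseries c x) (at x)"
      by (rule DERIV_mult[OF pseries_deriv[OF e] DERIV_chain2[OF DERIV_exp dT[OF x]]])
    moreover have "pseries (diffs c) x * exp (?T x) + exp (?T x) * pseries s x * pseries c x = 0"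
      by (simp add: pseries_log_deriv[OF e m ux] mult_ac)
    ultimately show "((\<lambda>x. pseries c x * exp (?T x)) has_field_derivative 0) (at x within ball 0 K)"
      by (metis has_field_derivative_at_within)
  qed simp
  then obtain k where k: "\<And>x. x \<in> ball 0 K \<Longrightarrow> pseries c x * exp (?T x) = k" by blast
  have "?T 0 = 0" using powser_zero[of t] by (simp add: t_def)
  then have "k = 1" using k[of 0] K0 by (simp add: pseries_0 c0)
  then have "pseries c z * exp (?T z) = 1" using k[of z] K by simp
  then have "pseries c z = exp (- ?T z)" by (simp add: exp_minus field_simps)
  then show ?thesis by blast
qed

text \<open>By \<open>s k \<ge> u ^ (k + 1)\<close> the logarithmic derivative satisfies \<open>- f' / f \<ge> u / (1 - u r)\<close>. Hence
  \<open>- f' r * (1 - u r) \<ge> u * f r\<close> for \<open>r < 1 / u\<close>, and \<open>r \<rightarrow> 1 / u\<close> leaves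
  \<open>0 \<ge> u * f (1 / u)\<close>. As \<open>f\<close> is positive below \<open>1 / u\<close>, the value is zero.\<close>
lemma pseries_zero_at_inverse:
  assumes e: "entire_coeffs c" and m: "root_moments c u s" and c0: "c 0 = 1" and u: "0 < u"
  shows "pseries c (1 / u) = (0 :: real)"
proof -
  define k where "k r = - pseries (diffs c) r * (1 - u * r) - u * pseries c r" for r :: real
  have pos: "0 < pseries c r" if "u * \<bar>r\<bar> < 1" for r :: real
    using pseries_eq_exp[OF e m c0, of r] that by auto
  have cont: "isCont (pseries c) x" "isCont (pseries (diffs c)) x" for x :: real
    using DERIV_isCont[OF pseries_deriv[OF e]] DERIV_isCont[OF pseries_deriv[OF entire_diffs[OF e]]]
    by auto
  have "isCont k (1 / u)" unfolding k_def by (intro continuous_intros cont)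
  then have lim: "(pseries c \<longlongrightarrow> pseries c (1 / u)) (at_left (1 / u))"
    "(k \<longlongrightarrow> k (1 / u)) (at_left (1 / u))"
    using cont(1)[of "1 / u"] unfolding isCont_def
    by (auto intro: filterlim_mono[OF _ order_refl at_le])
  have ev: "\<forall>\<^sub>F r in at_left (1 / u). 0 < r \<and> r < 1 / u"
    using eventually_at_left_real[of 0 "1 / u"] u by (simp add: greaterThanLessThan_iff)
  have "0 \<le> k r \<and> 0 \<le> pseries c r" if r: "0 < r" "r < 1 / u" for r
  proof -
    have ur: "u * r < 1" "0 < u * r" using r u by (auto simp: field_simps)
    have geo: "(\<lambda>i. u * (u * r) ^ i) sums (u * (1 / (1 - u * r)))"
      using ur by (intro sums_mult geometric_sums) auto
    have "u * (1 / (1 - u * r)) \<le> pseries s r"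
      unfolding pseries_def
    proof (rule sums_le[OF _ geo summable_sums])
      show "summable (\<lambda>n. of_real (s n) * r ^ n)"
        using moments_norm_summable[OF m, of r] ur r by (simp add: summable_norm_cancel)
      show "u * (u * r) ^ i \<le> of_real (s i) * r ^ i" for i
      proof -
        have "u ^ Suc i * r ^ i \<le> s i * r ^ i"
          using m r by (intro mult_right_mono) (auto simp: root_moments_def)
        then show ?thesis by (simp add: power_mult_distrib mult_ac)
      qed
    qed
    then have "u \<le> pseries s r * (1 - u * r)" using ur by (simp add: field_simps)
    then have "u * pseries c r \<le> pseries s r * (1 - u * r) * pseries c r"
      using pos[of r] r ur by (intro mult_right_mono) auto
    then show ?thesis
      using pseries_log_deriv[OF e m, of r] r ur pos[of r] by (simp add: k_def mult_ac)
  qed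
  then have ev': "\<forall>\<^sub>F r in at_left (1 / u). 0 \<le> k r" "\<forall>\<^sub>F r in at_left (1 / u). 0 \<le> pseries c r"
    using ev by (auto elim: eventually_mono)
  have "0 \<le> k (1 / u)" "0 \<le> pseries c (1 / u)"
    by (rule tendsto_lowerbound[OF lim(2) ev'(1)], simp, rule tendsto_lowerbound[OF lim(1) ev'(2)], simp)
  then show ?thesis using u by (simp add: k_def mult_le_0_iff)
qed

section \<open>Strict Euler--Rayleigh inequalities\<close>

text \<open>Equality \<open>s 2 = u * s 1\<close> would mean that all the mass of the power sums sits at \<open>u\<close> and \<open>0\<close>,
  so that \<open>f\<close> would be \<open>exp (- C z) * (1 - u z) ^ m\<close>. Such a function is excluded by the decay of
  its coefficients: Newton's identities reduce to a three-term recursion for \<open>c\<close>, which is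
  incompatible with ratios \<open>\<rho> n\<close> of consecutive coefficients that are positive and
  of smaller order than \<open>1 / n\<close>.\<close>
lemma root_moments_strict:
  assumes m: "root_moments c u s" and c0: "c 0 = 1"
    and rec: "\<And>n. c (Suc n) = - (\<rho> n * c n)" and pos: "\<And>n. 0 < \<rho> n"
    and lim: "(\<lambda>n. real (Suc n) * \<rho> n) \<longlonglongrightarrow> 0"
  shows "s 2 < u * s 1"
proof (rule ccontr)
  define D where "D k = u * s k - s (Suc k)" for k
  have u: "0 \<le> u" and D: "0 \<le> D k" "D (Suc k) \<le> u * D k" for k
    using m by (auto simp: root_moments_def D_def)
  have newton: "real (Suc n) * c (Suc n) = - (\<Sum>i\<le>n. s i * c (n - i))" for n
    using m by (auto simp: root_moments_def newton_sums_def)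
  assume "\<not> s 2 < u * s 1"
  then have "D 1 = 0" using D(1)[of 1] by (simp add: D_def numeral_2_eq_2)
  then have D0: "D (Suc k) = 0" for k
  proof (induction k)
    case (Suc k)
    then show ?case using D[of "Suc k"] D(1)[of "Suc (Suc k)"] by simp
  qed simp
  have cn: "c n \<noteq> 0" for n
  proof (induction n)
    case (Suc n)
    then show ?case using rec[of n] pos[of n] by simp
  qed (simp add: c0)
  have key: "real (Suc (Suc n)) * \<rho> (Suc n) * \<rho> n + u * (real (Suc n) * \<rho> n) - s 0 * \<rho> n = D 0" for n
  proof -
    have "(\<Sum>i\<le>n. D i * c (n - i)) = D 0 * c n"
    proof -
      have "(\<Sum>i\<le>n. D i * c (n - i)) = (\<Sum>i\<in>{0}. D i * c (n - i))"
      proof (rule sum.mono_neutral_right)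
        show "\<forall>i\<in>{..n} - {0}. D i * c (n - i) = 0"
          using D0 by (auto simp: gr0_conv_Suc)
      qed auto
      then show ?thesis by simp
    qed
    moreover have "(\<Sum>i\<le>n. D i * c (n - i))
        = u * (\<Sum>i\<le>n. s i * c (n - i)) - (\<Sum>i\<le>n. s (Suc i) * c (n - i))"
      by (simp add: D_def algebra_simps sum_subtractf sum_distrib_left)
    moreover have "(\<Sum>i\<le>n. s i * c (n - i)) = - (real (Suc n) * c (Suc n))"
      using newton[of n] by simp
    moreover have "(\<Sum>i\<le>n. s (Suc i) * c (n - i)) = - (real (Suc (Suc n)) * c (Suc (Suc n))) - s 0 * c (Suc n)"
      using newton[of "Suc n"] by (simp add: sum.atMost_Suc_shift del: of_nat_Suc sum.atMost_Suc)
    ultimately have "(real (Suc (Suc n)) * \<rho> (Suc n) * \<rho> n + u * (real (Suc n) * \<rho> n) - s 0 * \<rho> n) * c n = D 0 * c n"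
      by (simp add: rec algebra_simps del: of_nat_Suc)
    then show ?thesis using cn[of n] by simp
  qed
  have "\<rho> n \<le> real (Suc n) * \<rho> n" for n using pos[of n] by (simp add: distrib_right)
  then have rho0: "\<rho> \<longlonglongrightarrow> 0"
    using pos by (intro tendsto_sandwich[OF _ _ tendsto_const lim]) (auto intro: always_eventually less_imp_le)
  have "(\<lambda>n. real (Suc (Suc n)) * \<rho> (Suc n) * \<rho> n + u * (real (Suc n) * \<rho> n) - s 0 * \<rho> n)
      \<longlonglongrightarrow> 0 * 0 + u * 0 - s 0 * 0"
    by (intro tendsto_intros lim rho0 LIMSEQ_Suc[OF lim])
  then have "D 0 = 0" unfolding key by (simp add: LIMSEQ_const_iff)
  then have key': "real (Suc (Suc n)) * \<rho> (Suc n) + u * real (Suc n) = s 0" for n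
  proof -
    have "(real (Suc (Suc n)) * \<rho> (Suc n) + u * real (Suc n) - s 0) * \<rho> n = 0"
      using key[of n] \<open>D 0 = 0\<close> by (simp add: algebra_simps del: of_nat_Suc)
    then show ?thesis using pos[of n] by (simp del: of_nat_Suc)
  qed
  have le: "u * real (Suc n) \<le> s 0" for n
    using key'[of n] pos[of "Suc n"] by (smt (verit) mult_nonneg_nonneg of_nat_0_le_iff)
  have "u = 0"
  proof (rule ccontr)
    assume "u \<noteq> 0"
    then have "0 < u" using u by simp
    then obtain n where "s 0 < real n * u" using reals_Archimedean3 by blast
    then show False using le[of n] \<open>0 < u\<close> by (simp add: algebra_simps)
  qed
  then have "(\<lambda>n. s 0) \<longlonglongrightarrow> 0"
    using LIMSEQ_Suc[OF lim] key' by simp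
  then have "s 0 = 0" by (simp add: LIMSEQ_const_iff)
  then show False using newton[of 0] rec[of 0] pos[of 0] by (simp add: c0)
qed

text \<open>Each equality would propagate upwards: \<open>s 1 = u * s 0\<close> and \<open>s 1 = u\<^sup>2\<close> both force
  \<open>s 2 = u * s 1\<close>. So that single strict inequality makes all Euler--Rayleigh bounds strict.\<close>
lemma Euler_Rayleigh_strict:
  assumes m: "root_moments c u s" and strict: "s 2 < u * s 1"
  shows "0 < u" "0 < s 1" "0 < s 2" "s 1 < u * s 0" "u\<^sup>2 < s 1" "u < s 0"
proof -
  have u: "0 \<le> u" and ge: "u ^ Suc k \<le> s k" and le: "s (Suc k) \<le> u * s k"
    and D: "u * s (Suc k) - s (Suc (Suc k)) \<le> u * (u * s k - s (Suc k))" for k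
    using m by (auto simp: root_moments_def)
  have s2: "0 \<le> s 2" by (rule root_moments_nonneg[OF m])
  show u0: "0 < u"
  proof (rule ccontr)
    assume "\<not> 0 < u"
    then have "u = 0" using u by simp
    then show False using strict s2 by simp
  qed
  show "0 < s 1" "0 < s 2"
    using less_le_trans[OF zero_less_power[OF u0] ge[of 1]]
      less_le_trans[OF zero_less_power[OF u0] ge[of 2]] by auto
  show s1: "s 1 < u * s 0"
  proof (rule ccontr)
    assume "\<not> s 1 < u * s 0"
    then have "s 1 = u * s 0" using le[of 0] by simp
    then show False using D[of 0] strict by (simp add: numeral_2_eq_2)
  qed
  show u2: "u\<^sup>2 < s 1"
  proof (rule ccontr)
    assume "\<not> u\<^sup>2 < s 1"
    then have "s 1 = u\<^sup>2" using ge[of 1] by (simp add: numeral_2_eq_2)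
    then show False using ge[of 2] strict by (simp add: power2_eq_square eval_nat_numeral)
  qed
  have "u * u < u * s 0" using u2 s1 by (simp add: power2_eq_square)
  then show "u < s 0" using u0 by simp
qed

section \<open>The radius of convexity\<close>

text \<open>Here \<open>b\<close>, \<open>d\<close> and \<open>c\<close> are the coefficients of \<open>h / z\<close>, \<open>h'\<close> and \<open>(z h')'\<close>. The quotient in
  question is \<open>(z h')' / h' = 1 - z * (\<Sum>k. s k * z ^ k)\<close>. Since the power sums \<open>s\<close> of \<open>h'\<close> are
  nonnegative, its real part at \<open>z\<close> is at least its value at \<open>|z|\<close>, which is positive until
  \<open>(z h')'\<close> vanishes on the positive axis, at \<open>1 / u\<close>.\<close>
lemma radius_of_convexity_eq:
  assumes e: "entire_coeffs b" and b0: "b 0 = 1"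
    and md: "root_moments (\<lambda>n. real (Suc n) * b n) v s"
    and mc: "root_moments (\<lambda>n. (real (Suc n))\<^sup>2 * b n) u S" and u: "0 < u"
  shows "radius_of_convexity (\<lambda>z. z * pseries b z) = ereal (1 / u)"
proof -
  define d where "d n = real (Suc n) * b n" for n
  define c where "c n = real (Suc n) * d n" for n
  have c_eq: "(\<lambda>n. (real (Suc n))\<^sup>2 * b n) = c"
    by (simp add: c_def d_def fun_eq_iff power2_eq_square mult.assoc del: of_nat_Suc)
  have ed: "entire_coeffs d" unfolding d_def by (rule entire_Euler[OF e])
  have ec: "entire_coeffs c" unfolding c_def by (rule entire_Euler[OF ed])
  have md: "root_moments d v s" using md unfolding d_def[abs_def] .
  have mc: "root_moments c u S" using mc unfolding c_eq .
  have c0: "c 0 = 1" and d0: "d 0 = 1" using b0 by (auto simp: c_def d_def)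
  have v: "0 \<le> v" using md by (simp add: root_moments_def)
  have cd: "pseries c z = pseries d z + z * pseries (diffs d) z"
    for z :: "'a::{banach, real_normed_field}"
    unfolding c_def by (rule pseries_Euler[OF ed])
  have cs: "pseries c z = pseries d z * (1 - z * pseries s z)" if "v * norm z < 1"
    for z :: "'a::{banach, real_normed_field}"
    using pseries_log_deriv[OF ed md that] by (simp add: cd algebra_simps)
  have cpos: "0 < pseries c r" if "u * \<bar>r\<bar> < 1" for r :: real
    using pseries_eq_exp[OF ec mc c0, of r] that by auto
  have dpos: "0 < pseries d r" if "v * \<bar>r\<bar> < 1" for r :: real
    using pseries_eq_exp[OF ed md d0, of r] that by auto
  have dnz: "pseries d z \<noteq> 0" if "v * norm z < 1" for z :: complex
    using pseries_eq_exp[OF ed md d0 that] by auto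
  (* The zero 1 / u of (z h')' comes before the first zero 1 / v of h'. Already at half of 1 / v
     the power series of the quotient is at most 0, by comparison with a geometric series. *)
  have vu: "v < u"
  proof (rule ccontr)
    assume "\<not> v < u"
    then have v0: "0 < v" "u \<le> v" using u by auto
    define r where "r = 1 / (2 * v)"
    have r: "0 < r" "v * r = 1 / 2" using v0 by (auto simp: r_def)
    have "u * r \<le> v * r" using v0 r by (intro mult_right_mono) auto
    then have "0 < pseries c r" using r by (intro cpos) auto
    moreover have "1 \<le> r * pseries s r"
    proof -
      have "(\<lambda>i. r * (v * (1 / 2) ^ i)) sums (r * (v * 2))"
        using geometric_sums[of "1 / 2 :: real"] by (intro sums_mult) simp
      moreover have "r * (v * 2) = 1" using r(2) by (simp add: field_simps)
      ultimately have 1: "(\<lambda>i. r * (v * (1 / 2) ^ i)) sums 1" by simp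
      have "summable (\<lambda>n. of_real (s n) * r ^ n)"
        using moments_norm_summable[OF md, of r] r by (simp add: summable_norm_cancel)
      then have 2: "(\<lambda>n. r * (of_real (s n) * r ^ n)) sums (r * pseries s r)"
        unfolding pseries_def by (intro sums_mult summable_sums)
      show ?thesis
      proof (rule sums_le[OF _ 1 2])
        fix i
        have "v ^ Suc i * r ^ i \<le> s i * r ^ i"
          using md r by (intro mult_right_mono) (auto simp: root_moments_def)
        also have "v ^ Suc i * r ^ i = v * (v * r) ^ i" by (simp add: power_mult_distrib)
        also have "\<dots> = v * (1 / 2) ^ i" by (simp only: r(2))
        finally show "r * (v * (1 / 2) ^ i) \<le> r * (of_real (s i) * r ^ i)"
          using r(1) by (intro mult_left_mono) auto
      qed
    qed
    moreover have "pseries c r = pseries d r * (1 - r * pseries s r)" using r by (intro cs) simp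
    ultimately show False
      using dpos[of r] r by (simp add: zero_less_mult_iff)
  qed
  let ?h = "\<lambda>z::complex. z * pseries b z"
  have "(?h has_field_derivative pseries d z) (at z)" for z
  proof -
    have "(?h has_field_derivative (1 * pseries b z + pseries (diffs b) z * z)) (at z)"
      by (rule DERIV_mult[OF DERIV_ident pseries_deriv[OF e]])
    moreover have "1 * pseries b z + pseries (diffs b) z * z = pseries d z"
      unfolding d_def using pseries_Euler[OF e, of z] by (simp add: mult.commute)
    ultimately show ?thesis by simp
  qed
  then have deriv_h: "deriv ?h = pseries d" by (intro ext DERIV_imp_deriv)
  have deriv2_h: "(deriv ^^ 2) ?h = pseries (diffs d)"
  proof -
    have "deriv (pseries d) = (pseries (diffs d) :: complex \<Rightarrow> complex)"
      by (intro ext DERIV_imp_deriv pseries_deriv ed)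
    then show ?thesis by (simp add: numeral_2_eq_2 deriv_h)
  qed
  have quot: "1 + z * (deriv ^^ 2) ?h z / deriv ?h z = pseries c z / pseries d z"
    if "pseries d z \<noteq> 0" for z
    using that by (simp add: deriv_h deriv2_h cd field_simps)
  have good: "deriv ?h z \<noteq> 0 \<and> Re (1 + z * (deriv ^^ 2) ?h z / deriv ?h z) > 0"
    if z: "norm z < 1 / u" for z
  proof -
    have uz: "u * norm z < 1" using z u by (simp add: pos_less_divide_eq mult.commute)
    have "v * norm z \<le> u * norm z" using vu by (intro mult_right_mono) auto
    then have vz: "v * norm z < 1" using uz by linarith
    have nz: "pseries d z \<noteq> 0" by (rule dnz[OF vz])
    have sm: "summable (\<lambda>k. norm (of_real (s k) * z ^ k))" by (rule moments_norm_summable[OF md vz])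
    have "Re (z * pseries s z) \<le> norm z * norm (pseries s z)"
      using complex_Re_le_cmod[of "z * pseries s z"] by (simp add: norm_mult)
    also have "norm (pseries s z) \<le> pseries s (norm z)"
      using summable_norm[OF sm] root_moments_nonneg[OF md]
      by (simp add: pseries_def norm_mult norm_power)
    finally have "Re (z * pseries s z) \<le> norm z * pseries s (norm z)"
      by (simp add: mult_left_mono)
    moreover have "0 < 1 - norm z * pseries s (norm z)"
      using cs[of "norm z"] cpos[of "norm z"] dpos[of "norm z"] uz vz
      by (simp add: zero_less_mult_iff)
    ultimately have "0 < Re (1 - z * pseries s z)" by simp
    moreover have "pseries c z / pseries d z = 1 - z * pseries s z"
      using cs[OF vz] nz by simp
    ultimately show ?thesis using nz quot[OF nz] by (simp add: deriv_h)
  qed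
  have bad: "\<not> (0 < Re (1 + z * (deriv ^^ 2) ?h z / deriv ?h z))" if z: "z = of_real (1 / u)" for z
  proof -
    have "v * norm z < 1" using z u vu by (simp add: norm_divide)
    then have nz: "pseries d z \<noteq> 0" by (rule dnz)
    have "pseries c z = 0"
      unfolding z pseries_of_real[OF ec] pseries_zero_at_inverse[OF ec mc c0 u] by simp
    then show ?thesis using quot[OF nz] by simp
  qed
  let ?P = "\<lambda>r. r > 0 \<and> (\<forall>z\<in>ball 0 r. deriv ?h z \<noteq> 0 \<and>
          Re (1 + z * (deriv ^^ 2) ?h z / deriv ?h z) > 0)"
  have P: "?P r \<longleftrightarrow> 0 < r \<and> r \<le> 1 / u" for r
  proof
    assume r: "?P r"
    have "\<not> 1 / u < r"
    proof
      assume "1 / u < r"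
      then have "of_real (1 / u) \<in> ball (0::complex) r" using u by (simp add: norm_divide)
      then show False using r bad by blast
    qed
    then show "0 < r \<and> r \<le> 1 / u" using r by simp
  qed (use good in auto)
  show ?thesis
    unfolding radius_of_convexity_def P
  proof (rule Sup_eqI)
    show "y \<le> ereal (1 / u)" if "y \<in> {ereal r |r. 0 < r \<and> r \<le> 1 / u}" for y
      using that by auto
    show "ereal (1 / u) \<le> y" if "\<And>x. x \<in> {ereal r |r. 0 < r \<and> r \<le> 1 / u} \<Longrightarrow> x \<le> y" for y
      using u by (intro that) auto
  qed
qed

section \<open>The Jackson \<open>q\<close>-Bessel function\<close>

lemma h2_coeff_Suc:
  assumes "0 < q"
  shows "h2_coeff \<nu> q (Suc n) = - (q powr (\<nu> + 1) * (q ^ n)\<^sup>2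
    / (4 * (1 - q * q ^ n) * (1 - q powr (\<nu> + 1) * q ^ n))) * h2_coeff \<nu> q n"
proof -
  have "q powr (real (Suc n) * (real (Suc n) + \<nu>))
      = q powr (real n * (real n + \<nu>)) * (q powr (\<nu> + 1) * q powr real (n * 2))"
    by (simp add: powr_add [symmetric] algebra_simps)
  also have "q powr real (n * 2) = (q ^ n)\<^sup>2"
    using assms by (subst powr_realpow) (auto simp: power_mult)
  finally show ?thesis
    by (simp add: h2_coeff_def qpoch_Suc mult_ac del: right_diff_distrib_numeral)
qed

lemma h2_coeff_entire:
  assumes "\<nu> > - 1" "0 < q" "q < 1"
  shows "entire_coeffs (h2_coeff \<nu> q)"
  unfolding entire_coeffs_def
proof
  fix x :: real
  have "summable (\<lambda>n. Re (of_real (h2_coeff \<nu> q n) * of_real x ^ n))"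
    using h2_summable[OF assms] by (rule bounded_linear.summable[OF bounded_linear_Re])
  then show "summable (\<lambda>n. h2_coeff \<nu> q n * x ^ n)"
    by (simp flip: of_real_power)
qed

lemma h2_pseries:
  assumes "\<nu> > - 1" "0 < q" "q < 1"
  shows "h2 \<nu> q = (\<lambda>z. z * pseries (h2_coeff \<nu> q) z)"
proof
  fix z
  show "h2 \<nu> q z = z * pseries (h2_coeff \<nu> q) z"
    unfolding h2_series[OF assms] pseries_def suminf_mult[OF h2_summable[OF assms], symmetric]
    by (simp add: mult_ac)
qed

lemma jackson_J2_real:
  fixes x :: real
  assumes "\<nu> > - 1" "0 < q" "q < 1" "0 < x"
  shows "jackson_J2 \<nu> q x = qpoch_inf (q powr (\<nu> + 1)) q / qpoch_inf q q / 2 powr \<nu>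
    * x powr \<nu> * pseries (h2_coeff \<nu> q) (x\<^sup>2)"
proof -
  let ?Q = "qpoch_inf (q powr (\<nu> + 1)) q / qpoch_inf q q"
  have t: "(- 1) ^ n * (x / 2) powr of_real (2 * real n + \<nu>)
             / of_real (qpoch q q n * qpoch (q powr (\<nu> + 1)) q n)
             * of_real (q powr (real n * (real n + \<nu>)))
      = (x / 2) powr \<nu> * (of_real (h2_coeff \<nu> q n) * (x\<^sup>2) ^ n)" for n
  proof -
    have "(x / 2) powr (2 * real n + \<nu>) = (x / 2) powr real (2 * n) * (x / 2) powr \<nu>"
      by (simp add: powr_add)
    also have "(x / 2) powr real (2 * n) = (x / 2) ^ (2 * n)"
      using assms by (subst powr_realpow) auto
    also have "\<dots> = (x\<^sup>2) ^ n / 4 ^ n" by (simp add: power_mult power_divide)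
    finally show ?thesis by (simp add: h2_coeff_def mult_ac)
  qed
  have "jackson_J2 \<nu> q x = ?Q * ((x / 2) powr \<nu> * pseries (h2_coeff \<nu> q) (x\<^sup>2))"
    unfolding jackson_J2_def t pseries_def
    by (subst suminf_mult[OF entire_summable[OF h2_coeff_entire[OF assms(1-3)]]]) simp
  then show ?thesis using assms(4) by (simp add: powr_divide)
qed

text \<open>With \<open>h (x\<^sup>2)\<close> a multiple of \<open>x powr (2 - \<nu>) * J x\<close> and \<open>r = x\<^sup>2\<close>, the operator \<open>r d/dr\<close> becomes
  \<open>(x / 2) d/dx\<close>. Applying it twice shows that the left-hand side of the equation is a
  nonvanishing multiple of \<open>(r h')'\<close>, so both have the same positive zeros.\<close>
lemma convexity_lhs_pseries:
  assumes "\<nu> > - 1" "0 < q" "q < 1" "0 < r"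
  shows "\<exists>C. C \<noteq> 0 \<and> convexity_lhs \<nu> q r = C * pseries (\<lambda>n. (real (Suc n))\<^sup>2 * h2_coeff \<nu> q n) r"
proof -
  define a where "a = q powr (\<nu> + 1)"
  have a: "0 < a" "a < 1"
    using assms powr_less_mono2[of "\<nu> + 1" q 1] by (auto simp: a_def)
  define K where "K = qpoch_inf a q / qpoch_inf q q / 2 powr \<nu>"
  have K: "K \<noteq> 0" using qpoch_inf_nonzero[of q a] qpoch_inf_nonzero[of q q] a assms by (simp add: K_def)
  define b where "b = h2_coeff \<nu> q"
  have e: "entire_coeffs b" unfolding b_def by (rule h2_coeff_entire[OF assms(1-3)])
  define B where "B = (pseries b :: real \<Rightarrow> real)"
  define B1 where "B1 = (pseries (diffs b) :: real \<Rightarrow> real)"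
  define B2 where "B2 = (pseries (diffs (diffs b)) :: real \<Rightarrow> real)"
  have dB: "(B has_real_derivative B1 x) (at x)" "(B1 has_real_derivative B2 x) (at x)" for x
    unfolding B_def B1_def B2_def by (intro pseries_deriv e entire_diffs)+
  have J: "jackson_J2 \<nu> q x = K * x powr \<nu> * B (x\<^sup>2)" if "0 < x" for x
    using jackson_J2_real[OF assms(1-3) that] by (simp add: K_def a_def B_def b_def)
  define J1 where "J1 x = K * (\<nu> * x powr (\<nu> - 1) * B (x\<^sup>2) + x powr \<nu> * (B1 (x\<^sup>2) * (2 * x)))" for x
  have ev: "\<forall>\<^sub>F y in nhds x. 0 < y" if "0 < x" for x :: real
    using that by (intro eventually_nhds_in_open[of "{0<..}", simplified]) auto
  have "((\<lambda>x. K * x powr \<nu> * B (x\<^sup>2)) has_real_derivative J1 x) (at x)" if "0 < x" for x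
    unfolding J1_def using that
    by (auto intro!: derivative_eq_intros DERIV_chain2[OF dB(1)] simp: algebra_simps)
  then have dJ: "(jackson_J2 \<nu> q has_real_derivative J1 x) (at x)" if "0 < x" for x
    using that by (subst DERIV_cong_ev[OF refl eventually_mono[OF ev[OF that] J] refl]) auto
  define J2 where "J2 x = K * (\<nu> * ((\<nu> - 1) * x powr (\<nu> - 2)) * B (x\<^sup>2)
      + 2 * (\<nu> * x powr (\<nu> - 1) * (B1 (x\<^sup>2) * (2 * x)))
      + x powr \<nu> * (B2 (x\<^sup>2) * (2 * x) * (2 * x) + 2 * B1 (x\<^sup>2)))" for x
  have dJ1: "(J1 has_real_derivative J2 x) (at x)" if "0 < x" for x
    unfolding J1_def J2_def using that
    by (auto intro!: derivative_eq_intros DERIV_chain2[OF dB(1)] DERIV_chain2[OF dB(2)]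
        simp: algebra_simps)
  have dJ': "(deriv (jackson_J2 \<nu> q) has_real_derivative J2 x) (at x)" if "0 < x" for x :: real
  proof -
    have "\<forall>\<^sub>F y in nhds x. deriv (jackson_J2 \<nu> q) y = J1 y"
      using ev[OF that] by (rule eventually_mono) (rule DERIV_imp_deriv[OF dJ])
    from DERIV_cong_ev[OF refl this refl] show ?thesis using dJ1[OF that] by blast
  qed
  have dd: "(deriv ^^ 2) (jackson_J2 \<nu> q) x = J2 x" if "0 < x" for x :: real
    using DERIV_imp_deriv[OF dJ'[OF that]] by (simp add: numeral_2_eq_2)
  define y where "y = sqrt r"
  have y: "0 < y" "y\<^sup>2 = r" using assms by (auto simp: y_def)
  have p1: "y * y powr (\<nu> - 1) = y powr \<nu>" and p2: "y\<^sup>2 * y powr (\<nu> - 2) = y powr \<nu>"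
    using y(1) by (simp_all add: powr_diff powr_numeral)
  have "convexity_lhs \<nu> q r = (2 - \<nu>)\<^sup>2 * (K * y powr \<nu> * B r) + (5 - 2 * \<nu>) * (y * J1 y) + y\<^sup>2 * J2 y"
    unfolding convexity_lhs_def y_def[symmetric]
    using J[OF y(1)] DERIV_imp_deriv[OF dJ[OF y(1)]] dd[OF y(1)] y by simp
  also have "y * J1 y = K * y powr \<nu> * (\<nu> * B r + 2 * r * B1 r)"
  proof -
    have "y * J1 y = K * (\<nu> * (y * y powr (\<nu> - 1)) * B r + 2 * y powr \<nu> * y\<^sup>2 * B1 r)"
      by (simp add: J1_def y(2) algebra_simps power2_eq_square[of y, symmetric])
    then show ?thesis unfolding p1 y(2) by (simp add: algebra_simps)
  qed
  also have "y\<^sup>2 * J2 y = K * y powr \<nu> *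
      (\<nu> * (\<nu> - 1) * B r + 4 * \<nu> * r * B1 r + 4 * r\<^sup>2 * B2 r + 2 * r * B1 r)"
  proof -
    have "y\<^sup>2 * J2 y = K * (\<nu> * (\<nu> - 1) * (y\<^sup>2 * y powr (\<nu> - 2)) * B r
        + 4 * \<nu> * (y * y powr (\<nu> - 1)) * y\<^sup>2 * B1 r
        + y powr \<nu> * (4 * (y\<^sup>2)\<^sup>2 * B2 r + 2 * y\<^sup>2 * B1 r))"
      unfolding J2_def y(2)[symmetric] by (simp add: algebra_simps power2_eq_square)
    then show ?thesis unfolding p1 p2 unfolding y(2) by (simp add: algebra_simps)
  qed
  also have "(2 - \<nu>)\<^sup>2 * (K * y powr \<nu> * B r)
      + (5 - 2 * \<nu>) * (K * y powr \<nu> * (\<nu> * B r + 2 * r * B1 r))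
      + K * y powr \<nu> * (\<nu> * (\<nu> - 1) * B r + 4 * \<nu> * r * B1 r + 4 * r\<^sup>2 * B2 r + 2 * r * B1 r)
      = (4 * K * y powr \<nu>) * (B r + 3 * r * B1 r + r\<^sup>2 * B2 r)"
    by (simp add: algebra_simps power2_eq_square)
  also have "B r + 3 * r * B1 r + r\<^sup>2 * B2 r = pseries (\<lambda>n. (real (Suc n))\<^sup>2 * b n) r"
  proof -
    define d where "d n = real (Suc n) * b n" for n
    have ed: "entire_coeffs d" unfolding d_def by (rule entire_Euler[OF e])
    have d: "pseries d = (\<lambda>x. B x + x * B1 x)"
      unfolding d_def B_def B1_def by (rule ext, rule pseries_Euler[OF e])
    have "(pseries d has_real_derivative (B1 r + (1 * B1 r + B2 r * r))) (at r)"
      unfolding d by (intro DERIV_add DERIV_mult DERIV_ident dB)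
    then have dd: "pseries (diffs d) r = B1 r + (1 * B1 r + B2 r * r)"
      using DERIV_unique[OF pseries_deriv[OF ed]] by blast
    have "(\<lambda>n. (real (Suc n))\<^sup>2 * b n) = (\<lambda>n. real (Suc n) * d n)"
      by (simp add: d_def power2_eq_square mult.assoc)
    then show ?thesis
      using pseries_Euler[OF ed, of r] by (simp add: d dd algebra_simps power2_eq_square)
  qed
  finally have "convexity_lhs \<nu> q r = (4 * K * y powr \<nu>) * pseries (\<lambda>n. (real (Suc n))\<^sup>2 * b n) r" .
  then show ?thesis using K y unfolding b_def by (intro exI[of _ "4 * K * y powr \<nu>"]) simp
qed

lemma h2_coeff_values:
  assumes "\<nu> > - 1" "0 < q" "q < 1" and a: "a = q powr (\<nu> + 1)"
  shows "h2_coeff \<nu> q 0 = 1"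
    and "h2_coeff \<nu> q 1 = - a / (4 * (1 - q) * (1 - a))"
    and "h2_coeff \<nu> q 2 = a\<^sup>2 * q\<^sup>2 / (16 * (1 - q) * (1 - q\<^sup>2) * (1 - a) * (1 - a * q))"
    and "h2_coeff \<nu> q 3 = - (a ^ 3 * q ^ 6)
      / (64 * (1 - q) * (1 - q\<^sup>2) * (1 - q ^ 3) * (1 - a) * (1 - a * q) * (1 - a * q\<^sup>2))"
proof -
  show 0: "h2_coeff \<nu> q 0 = 1" using assms by (simp add: h2_coeff_def qpoch_def)
  show 1: "h2_coeff \<nu> q 1 = - a / (4 * (1 - q) * (1 - a))"
    using h2_coeff_Suc[OF assms(2), of \<nu> 0] 0 by (simp add: a)
  have 2: "h2_coeff \<nu> q 2 = - (a * q\<^sup>2 / (4 * (1 - q\<^sup>2) * (1 - a * q))) * h2_coeff \<nu> q 1"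
    using h2_coeff_Suc[OF assms(2), of \<nu> 1] by (simp add: a numeral_2_eq_2)
  then show 2: "h2_coeff \<nu> q 2 = a\<^sup>2 * q\<^sup>2 / (16 * (1 - q) * (1 - q\<^sup>2) * (1 - a) * (1 - a * q))"
    unfolding 1 by (simp add: power2_eq_square mult_ac del: right_diff_distrib_numeral left_diff_distrib_numeral)
  have "h2_coeff \<nu> q 3 = - (a * (q\<^sup>2)\<^sup>2 / (4 * (1 - q * q\<^sup>2) * (1 - a * q\<^sup>2))) * h2_coeff \<nu> q 2"
    using h2_coeff_Suc[OF assms(2), of \<nu> 2] by (simp add: a numeral_3_eq_3 numeral_2_eq_2)
  also have "q * q\<^sup>2 = q ^ 3" by (simp add: power2_eq_square power3_eq_cube)
  finally show "h2_coeff \<nu> q 3 = - (a ^ 3 * q ^ 6)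
      / (64 * (1 - q) * (1 - q\<^sup>2) * (1 - q ^ 3) * (1 - a) * (1 - a * q) * (1 - a * q\<^sup>2))"
    unfolding 2 by (simp add: power2_eq_square power3_eq_cube eval_nat_numeral mult_ac
        del: right_diff_distrib_numeral left_diff_distrib_numeral)
qed

section \<open>Explicit bounds\<close>

text \<open>The letters \<open>x, w, t, y, z, p\<close> stand for the factors \<open>1 - q\<close>, \<open>1 + q\<close>, \<open>1 + q + q\<^sup>2\<close>, \<open>1 - a\<close>, \<open>1 - a q\<close> and
  \<open>1 - a q\<^sup>2\<close>. Treating them as independent keeps the common denominators visible: the
  numerators below are the polynomials \<open>U\<close> and \<open>M + N\<close>.\<close>
lemma Euler_Rayleigh_sums_algebra:
  fixes a q x w t y z p :: real
  assumes "x \<noteq> 0" "w \<noteq> 0" "t \<noteq> 0" "y \<noteq> 0" "z \<noteq> 0" "p \<noteq> 0"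
    and c1: "c1 = - (a / (x * y))"
    and c2: "c2 = 9 * a\<^sup>2 * q\<^sup>2 / (16 * x\<^sup>2 * w * y * z)"
    and c3: "c3 = - (a ^ 3 * q ^ 6 / (4 * x ^ 3 * w * t * y * z * p))"
    and s1: "s1 = c1\<^sup>2 - 2 * c2" and s2: "s2 = - (3 * c3 - c1 * c2 + s1 * c1)"
  shows "s1 = a\<^sup>2 * (8 * w * z - 9 * q\<^sup>2 * y) / (8 * x\<^sup>2 * y\<^sup>2 * w * z)"
    and "s2 = a ^ 3 * (12 * q ^ 6 * y\<^sup>2 - 9 * q\<^sup>2 * y * t * p + 2 * (8 * w * z - 9 * q\<^sup>2 * y) * t * p)
      / (16 * x ^ 3 * w * t * y ^ 3 * z * p)"
proof -
  show s1': "s1 = a\<^sup>2 * (8 * w * z - 9 * q\<^sup>2 * y) / (8 * x\<^sup>2 * y\<^sup>2 * w * z)"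
    unfolding s1 c1 c2 using assms(1-6) by (simp add: field_simps power2_eq_square)
  show "s2 = a ^ 3 * (12 * q ^ 6 * y\<^sup>2 - 9 * q\<^sup>2 * y * t * p + 2 * (8 * w * z - 9 * q\<^sup>2 * y) * t * p)
      / (16 * x ^ 3 * w * t * y ^ 3 * z * p)"
    unfolding s2 s1' c1 c2 c3 using assms(1-6)
    by (simp add: field_simps power2_eq_square power3_eq_cube)
qed

theorem theorem2:
  fixes \<nu> q :: real
  assumes "\<nu> > - 1" and "0 < q" and "q < 1"
  shows "\<exists>rc::real.
      radius_of_convexity (h2 \<nu> q) = ereal rc
    \<and> (rc > 0 \<and> convexity_lhs \<nu> q rc = 0
       \<and> (\<forall>s>0. convexity_lhs \<nu> q s = 0 \<longrightarrow> rc \<le> s))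
    \<and> (1 - q) * (1 - q powr (\<nu> + 1)) / q powr (\<nu> + 1) < rc
    \<and> rc < 8 * (q powr (\<nu> + 1) - 1) * (q powr (\<nu> + 2) - 1) * (1 - q^2)
            / (q powr (\<nu> + 1) * U_poly \<nu> q)
    \<and> sqrt (8 * (1 - q)^2 * (1 + q) * (1 - q powr (\<nu> + 1))^2 * (1 - q powr (\<nu> + 2))
            / (q powr (2 * \<nu> + 2) * U_poly \<nu> q)) < rc
    \<and> rc < 2 * (1 - q powr (\<nu> + 1)) * (q powr (\<nu> + 3) - 1) * U_poly \<nu> q * T_poly q
            / ((1 + q) * q powr (\<nu> + 1) * (M_poly \<nu> q + N_poly \<nu> q))"
proof -
  define a where "a = q powr (\<nu> + 1)"
  have a: "0 < a" "a < 1"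
    using assms powr_less_mono2[of "\<nu> + 1" q 1] by (auto simp: a_def)
  define b where "b = h2_coeff \<nu> q"
  define c where "c n = (real (Suc n))\<^sup>2 * b n" for n
  obtain v s where md: "root_moments (\<lambda>n. real (Suc n) * b n) v s"
    using h2_coeff_root_moments(1)[OF assms] unfolding b_def by blast
  obtain u S where mc: "root_moments c u S"
    using h2_coeff_root_moments(2)[OF assms] unfolding c_def b_def by blast
  have eb: "entire_coeffs b" unfolding b_def by (rule h2_coeff_entire[OF assms])
  have ec: "entire_coeffs c"
    using entire_Euler[OF entire_Euler[OF eb]] by (simp add: c_def[abs_def] power2_eq_square mult.assoc)
  note bv = h2_coeff_values[OF assms a_def, folded b_def]
  have c0: "c 0 = 1" using bv(1) by (simp add: c_def)
  have aq: "a * q ^ n < 1" for n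
  proof -
    have "a * q ^ n \<le> a * 1" using a assms by (intro mult_left_mono power_le_one) auto
    then show ?thesis using a by linarith
  qed
  have qn: "q ^ Suc n < 1" for n
    using assms by (intro power_Suc_less_one) auto

  (* The ratio of consecutive coefficients; it decays like q ^ (2 n). *)
  define \<rho> where "\<rho> n = (1 + inverse (real (Suc n)))\<^sup>2 * (a * (q ^ n)\<^sup>2 / (4 * (1 - q * q ^ n) * (1 - a * q ^ n)))" for n
  have rec: "c (Suc n) = - (\<rho> n * c n)" for n
  proof -
    have "(real (Suc (Suc n)))\<^sup>2 = (1 + inverse (real (Suc n)))\<^sup>2 * (real (Suc n))\<^sup>2"
      by (simp add: power_mult_distrib[symmetric] field_simps)
    then show ?thesis
      unfolding c_def b_def h2_coeff_Suc[OF assms(2)] \<rho>_def a_def by (simp add: mult_ac del: of_nat_Suc)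
  qed
  have rho_pos: "0 < \<rho> n" for n
    unfolding \<rho>_def using a assms aq[of n] qn[of n]
    by (intro mult_pos_pos divide_pos_pos zero_less_power) (auto simp: add_pos_pos)
  have rho_lim: "(\<lambda>n. real (Suc n) * \<rho> n) \<longlonglongrightarrow> 0"
  proof -
    have q0: "(\<lambda>n. q ^ n) \<longlonglongrightarrow> 0" using assms by (intro LIMSEQ_realpow_zero) auto
    have nq: "(\<lambda>n. real n * q ^ n) \<longlonglongrightarrow> 0" using assms by (intro powser_times_n_limit_0) auto
    have "(\<lambda>n. (1 + inverse (real (Suc n)))\<^sup>2 *
        (a * ((real n * q ^ n + q ^ n) * q ^ n) / (4 * (1 - q * q ^ n) * (1 - a * q ^ n))))
        \<longlonglongrightarrow> (1 + 0)\<^sup>2 * (a * ((0 + 0) * 0) / (4 * (1 - q * 0) * (1 - a * 0)))"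
      by (intro tendsto_intros q0 nq LIMSEQ_inverse_real_of_nat) auto
    moreover have "(1 + inverse (real (Suc n)))\<^sup>2 *
        (a * ((real n * q ^ n + q ^ n) * q ^ n) / (4 * (1 - q * q ^ n) * (1 - a * q ^ n)))
        = real (Suc n) * \<rho> n" for n
      unfolding \<rho>_def by (simp add: power2_eq_square[of "q ^ n"] algebra_simps)
    ultimately show ?thesis by simp
  qed
  have strict: "S 2 < u * S 1" by (rule root_moments_strict[OF mc c0 rec rho_pos rho_lim])
  note ER = Euler_Rayleigh_strict[OF mc strict]
  have radius: "radius_of_convexity (h2 \<nu> q) = ereal (1 / u)"
    unfolding h2_pseries[OF assms] b_def[symmetric]
    using radius_of_convexity_eq[OF eb bv(1) md mc[unfolded c_def] ER(1)] .
  have root: "convexity_lhs \<nu> q (1 / u) = 0"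
    using convexity_lhs_pseries[OF assms, of "1 / u"] pseries_zero_at_inverse[OF ec mc c0 ER(1)] ER(1)
    by (auto simp: c_def[abs_def] b_def)
  have least: "1 / u \<le> r" if "0 < r" "convexity_lhs \<nu> q r = 0" for r
  proof (rule ccontr)
    assume "\<not> 1 / u \<le> r"
    then have "u * norm r < 1" using that ER(1) by (simp add: field_simps)
    then have "pseries c r \<noteq> 0" using pseries_eq_exp[OF ec mc c0, of r] by auto
    then show False
      using convexity_lhs_pseries[OF assms that(1)] that(2) by (auto simp: c_def[abs_def] b_def)
  qed

  define x w t y z p where
    xs: "x = 1 - q" "w = 1 + q" "t = 1 + q + q\<^sup>2" "y = 1 - a" "z = 1 - a * q" "p = 1 - a * q\<^sup>2"
  have nz: "0 < x" "0 < w" "0 < t" "0 < y" "0 < z" "0 < p"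
    using assms a aq[of 1] aq[of 2] by (auto simp: xs add_pos_nonneg)
  have q2: "1 - q\<^sup>2 = x * w" and q3: "1 - q ^ 3 = x * t"
    by (simp_all add: xs algebra_simps power2_eq_square power3_eq_cube)
  have newton: "real (Suc n) * c (Suc n) = - (\<Sum>i\<le>n. S i * c (n - i))" for n
    using mc by (auto simp: root_moments_def newton_sums_def)
  have S0: "S 0 = - c 1" using newton[of 0] c0 by simp
  have S1: "S 1 = (c 1)\<^sup>2 - 2 * c 2"
    using newton[of 1] S0 c0 by (simp add: numeral_2_eq_2 power2_eq_square)
  have S2: "S 2 = - (3 * c 3 - c 1 * c 2 + S 1 * c 1)"
    using newton[of 2] S0 c0 by (simp add: numeral_2_eq_2 numeral_3_eq_3)
  have cv: "c 1 = - (a / (x * y))" "c 2 = 9 * a\<^sup>2 * q\<^sup>2 / (16 * x\<^sup>2 * w * y * z)"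
    "c 3 = - (a ^ 3 * q ^ 6 / (4 * x ^ 3 * w * t * y * z * p))"
    unfolding c_def bv(2,3,4) q2 q3 xs(1,4-6)[symmetric]
    by (simp_all add: power2_eq_square power3_eq_cube mult_ac)
  note sums = Euler_Rayleigh_sums_algebra[OF _ _ _ _ _ _ cv S1 S2]
  have U: "U_poly \<nu> q = 8 * w * z - 9 * q\<^sup>2 * y"
    and MN: "M_poly \<nu> q + N_poly \<nu> q
      = 12 * q ^ 6 * y\<^sup>2 - 9 * q\<^sup>2 * y * t * p + 2 * (8 * w * z - 9 * q\<^sup>2 * y) * t * p"
    and T: "T_poly q = - (x * w * t)"
    and pw: "q powr (\<nu> + 2) = a * q" "q powr (\<nu> + 3) = a * q\<^sup>2" "q powr (2 * \<nu> + 2) = a\<^sup>2"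
  proof -
    have pw1: "q powr (\<nu> + real (Suc n)) = a * q ^ n" for n
    proof -
      have "q powr (\<nu> + real (Suc n)) = q powr (\<nu> + 1) * q powr real n"
        by (simp add: powr_add[symmetric] add_ac)
      then show ?thesis using assms by (simp add: a_def powr_realpow)
    qed
    have pw2: "q powr (2 * \<nu> + real (Suc (Suc n))) = a\<^sup>2 * q ^ n" for n
    proof -
      have "q powr (2 * \<nu> + real (Suc (Suc n))) = q powr (\<nu> + 1) * q powr (\<nu> + 1) * q powr real n"
        by (simp add: powr_add[symmetric] add_ac)
      then show ?thesis using assms by (simp add: a_def powr_realpow power2_eq_square)
    qed
    note pws = pw1[of 1, simplified] pw1[of 2, simplified] pw1[of 3, simplified] pw1[of 4, simplified]
      pw1[of 5, simplified] pw1[of 6, simplified] pw2[of 0, simplified] pw2[of 3, simplified]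
      pw2[of 4, simplified] pw2[of 5, simplified] pw2[of 6, simplified]
    show "q powr (\<nu> + 2) = a * q" "q powr (\<nu> + 3) = a * q\<^sup>2" "q powr (2 * \<nu> + 2) = a\<^sup>2"
      using pws by simp_all
    show "U_poly \<nu> q = 8 * w * z - 9 * q\<^sup>2 * y"
      unfolding U_poly_def pws xs by (simp add: algebra_simps power2_eq_square)
    show "M_poly \<nu> q + N_poly \<nu> q
      = 12 * q ^ 6 * y\<^sup>2 - 9 * q\<^sup>2 * y * t * p + 2 * (8 * w * z - 9 * q\<^sup>2 * y) * t * p"
      unfolding M_poly_def N_poly_def pws xs by (simp add: algebra_simps eval_nat_numeral)
    show "T_poly q = - (x * w * t)"
      unfolding T_poly_def xs by (simp add: algebra_simps eval_nat_numeral)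
  qed
  have S1v: "S 1 = a\<^sup>2 * U_poly \<nu> q / (8 * x\<^sup>2 * y\<^sup>2 * w * z)"
    unfolding U using nz by (intro sums(1)) auto
  have S2v: "S 2 = a ^ 3 * (M_poly \<nu> q + N_poly \<nu> q) / (16 * x ^ 3 * w * t * y ^ 3 * z * p)"
    unfolding MN using nz by (intro sums(2)) auto
  have S0v: "S 0 = a / (x * y)" using S0 cv(1) by simp
  have "U_poly \<nu> q \<noteq> 0" "M_poly \<nu> q + N_poly \<nu> q \<noteq> 0" using ER(2,3) S1v S2v by auto
  note ne = this nz a

  have "(1 - q) * (1 - a) / a = 1 / S 0" unfolding S0v xs by simp
  also have "\<dots> < 1 / u" using ER(1,6) by (intro divide_strict_left_mono) auto
  finally have bound1: "(1 - q) * (1 - a) / a < 1 / u" .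
  have "1 / u < S 0 / S 1" using ER(1,2,4) by (simp add: field_simps)
  also have "\<dots> = 8 * (a - 1) * (a * q - 1) * (1 - q\<^sup>2) / (a * U_poly \<nu> q)"
  proof -
    have "S 0 / S 1 = 8 * y * z * (x * w) / (a * U_poly \<nu> q)"
      unfolding S0v S1v using ne by (simp add: field_simps power2_eq_square)
    also have "8 * y * z * (x * w) = 8 * (a - 1) * (a * q - 1) * (1 - q\<^sup>2)"
      unfolding q2 by (simp add: xs algebra_simps)
    finally show ?thesis .
  qed
  finally have bound2: "1 / u < 8 * (a - 1) * (a * q - 1) * (1 - q\<^sup>2) / (a * U_poly \<nu> q)" .
  have "8 * (1 - q)\<^sup>2 * (1 + q) * (1 - a)\<^sup>2 * (1 - a * q) / (a\<^sup>2 * U_poly \<nu> q) = 1 / S 1"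
    unfolding S1v xs by (simp add: mult_ac)
  also have "\<dots> < 1 / u\<^sup>2" using ER(1,2,5) by (intro divide_strict_left_mono) auto
  also have "\<dots> = (1 / u)\<^sup>2" by (simp add: power_divide)
  finally have "sqrt (8 * (1 - q)\<^sup>2 * (1 + q) * (1 - a)\<^sup>2 * (1 - a * q) / (a\<^sup>2 * U_poly \<nu> q))
      < sqrt ((1 / u)\<^sup>2)" by (rule real_sqrt_less_mono)
  then have bound3: "sqrt (8 * (1 - q)\<^sup>2 * (1 + q) * (1 - a)\<^sup>2 * (1 - a * q) / (a\<^sup>2 * U_poly \<nu> q)) < 1 / u"
    using ER(1) by simp
  have "1 / u < S 1 / S 2" using ER(1,3) strict by (simp add: field_simps)
  also have "\<dots> = 2 * (1 - a) * (a * q\<^sup>2 - 1) * U_poly \<nu> q * T_poly q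
      / ((1 + q) * a * (M_poly \<nu> q + N_poly \<nu> q))"
  proof -
    have "S 1 / S 2 = 2 * y * p * U_poly \<nu> q * (x * w * t) / (w * a * (M_poly \<nu> q + N_poly \<nu> q))"
    proof -
      have "a\<^sup>2 * V / (8 * x\<^sup>2 * y\<^sup>2 * w * z) / (a ^ 3 * Q / (16 * x ^ 3 * w * t * y ^ 3 * z * p))
          = 2 * y * p * V * (x * w * t) / (w * a * Q)" if "Q \<noteq> 0" for V Q :: real
        using that nz a by (simp add: field_simps power2_eq_square power3_eq_cube)
      then show ?thesis unfolding S1v S2v using ne(2) .
    qed
    also have "2 * y * p * U_poly \<nu> q * (x * w * t)
        = 2 * (1 - a) * (a * q\<^sup>2 - 1) * U_poly \<nu> q * T_poly q"
      unfolding T by (simp add: xs(4,6) algebra_simps)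
    finally show ?thesis by (simp add: xs(2))
  qed
  finally have bound4: "1 / u < 2 * (1 - a) * (a * q\<^sup>2 - 1) * U_poly \<nu> q * T_poly q
      / ((1 + q) * a * (M_poly \<nu> q + N_poly \<nu> q))" .
  show ?thesis
    unfolding pw a_def[symmetric]
    using radius root least ER(1) bound1 bound2 bound3 bound4 by (intro exI[of _ "1 / u"]) auto
qed

end
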